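(* There exists $M$, depending only on the representation $\mathfrak r$ of $H$, such that for all sufficiently small $\epsilon>0$ and all $\delta>0$ sufficiently small depending on $\epsilon$ the following holds. For every $A\subseteq B_1^{\mathfrak r}(0)$, the exceptional set $$\mathcal E(A)=\left\{u\in\mathsf B_1^U:\ \exists A'\subseteq A\text{ with }|A'|_\delta\ge\delta^\epsilon|A|_\delta\text{ and }|\pi_u^{(1)}(A')|_\delta<\delta^{M\epsilon}|A|_\delta^{\frac39}\right\}$$ satisfies $m_U(\mathcal E(A))\le\delta^\epsilon$.
   Context: $Q$ is either $x_2x_3-x_1x_4$ or $x_2^2+x_3^2-2x_1x_4$ on $\mathbb R^4$, $H=\mathrm{SO}(Q)^\circ\subset\mathrm{SL}_4(\mathbb R)$ (identity component), $\mathfrak h=\mathrm{Lie}(H)$; the result is asserted for each choice. Writing $Q$ also for the symmetric matrix of the form, $\mathfrak r=\{x\in\mathfrak{sl}_4(\mathbb R):Qx^tQ^{-1}=x\}$ is the $\mathrm{Ad}(H)$-invariant complement of $\mathfrak h$ in $\mathfrak{sl}_4(\mathbb R)$, an irreducible representation of $H$ with $\dim\mathfrak r=9$. $U=\{u_{r,s}:r,s\in\mathbb R\}$ with $u_{r,s}=\begin{pmatrix}1&r&s&sr\\&1&&s\\&&1&r\\&&&1\end{pmatrix}$ for the first form and $u_{r,s}=\begin{pmatrix}1&r&s&(r^2+s^2)/2\\&1&&r\\&&1&s\\&&&1\end{pmatrix}$ for the second; $\mathsf B_1^U=\{u_{r,s}:|r|,|s|\le1\}$ and $m_U$ is the Haar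 measure on $U$ with $m_U(\mathsf B_1^U)=1$. $B_1^{\mathfrak r}(0)$ is the unit ball for the max norm of $\mathrm{Mat}_4(\mathbb R)$; $|\cdot|_\delta$ is the $\delta$-covering number. Let $\mathbf a=\mathrm{diag}(1,0,0,-1)$; $\mathrm{ad}\,\mathbf a$ acts on $\mathfrak r$ with eigenvalues $-2,-1,0,1,2$ and eigenspaces $\mathfrak r_\lambda$ of dimensions $1,2,3,2,1$. $\mathfrak r^{(\lambda)}=\bigoplus_{\mu\ge\lambda}\mathfrak r_\mu$, $\pi^{(\lambda)}:\mathfrak r\to\mathfrak r^{(\lambda)}$ is the orthogonal projection for the standard inner product of $\mathrm{Mat}_4(\mathbb R)$, and $\pi_u^{(\lambda)}=\pi^{(\lambda)}\circ\mathrm{Ad}(u)$. Thus $\dim\mathfrak r^{(1)}=3$. *)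

theory Defs
  imports "HOL-Analysis.Analysis"
begin

section \<open>The two quadratic forms and the representation\<close>

text \<open>The two choices of \<open>Q\<close>, named after their signatures \<open>(2,2)\<close> and \<open>(3,1)\<close>.\<close>

datatype form = Form22 | Form31

primrec qform :: "form \<Rightarrow> real^4 \<Rightarrow> real" where
  "qform Form22 x = x$2 * x$3 - x$1 * x$4"
| "qform Form31 x = (x$2)\<^sup>2 + (x$3)\<^sup>2 - 2 * x$1 * x$4"

text \<open>The symmetric matrix of the form, by polarization: its \<open>(i,j)\<close> entry is the value of the
  associated symmetric bilinear form at the \<open>i\<close>-th and \<open>j\<close>-th standard basis vectors.\<close>

definition qmat :: "form \<Rightarrow> real^4^4" where
  "qmat F = (\<chi> i j. (qform F (axis i 1 + axis j 1) - qform F (axis i 1) - qform F (axis j 1)) / 2)"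

definition rrep :: "form \<Rightarrow> (real^4^4) set" where
  "rrep F = {x. trace x = 0 \<and> qmat F ** transpose x ** matrix_inv (qmat F) = x}"

text \<open>The norm \<^const>\<open>infnorm\<close> on \<^typ>\<open>real^4^4\<close> is the maximum of the absolute values of the
  entries.\<close>

definition unit_ball_rrep :: "form \<Rightarrow> (real^4^4) set" where
  "unit_ball_rrep F = {x \<in> rrep F. infnorm x \<le> 1}"

definition Ad :: "real^'n^'n \<Rightarrow> real^'n^'n \<Rightarrow> real^'n^'n" where
  "Ad g x = g ** x ** matrix_inv g"


section \<open>The unipotent group and its Haar measure\<close>

primrec umat :: "form \<Rightarrow> real \<Rightarrow> real \<Rightarrow> real^4^4" where
  "umat Form22 r s = vector [vector [1, r, s, s * r],
                             vector [0, 1, 0, s],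
                             vector [0, 0, 1, r],
                             vector [0, 0, 0, 1]]"
| "umat Form31 r s = vector [vector [1, r, s, (r\<^sup>2 + s\<^sup>2) / 2],
                             vector [0, 1, 0, r],
                             vector [0, 0, 1, s],
                             vector [0, 0, 0, 1]]"

definition ugroup :: "form \<Rightarrow> (real^4^4) set" where
  "ugroup F = {umat F r s |r s. True}"

definition ubox :: "form \<Rightarrow> (real^4^4) set" where
  "ubox F = {umat F r s |r s. \<bar>r\<bar> \<le> 1 \<and> \<bar>s\<bar> \<le> 1}"

text \<open>Left Haar measures on a closed group \<open>G\<close> of matrices, as Borel measures on \<open>G\<close>. Regularity
  is not required separately: it is automatic because \<open>G\<close> is locally compact and second
  countable.\<close>

definition haar_measure_on :: "(real^'n^'n) set \<Rightarrow> (real^'n^'n) measure \<Rightarrow> bool" where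
  "haar_measure_on G m \<longleftrightarrow>
     sets m = sets (restrict_space borel G) \<and>
     (\<forall>g\<in>G. \<forall>S\<in>sets m. emeasure m ((\<lambda>x. g ** x) ` S) = emeasure m S) \<and>
     (\<forall>K\<subseteq>G. compact K \<longrightarrow> emeasure m K < \<infinity>) \<and>
     emeasure m G \<noteq> 0"


section \<open>The projections\<close>

definition amat :: "real^4^4" where
  "amat = vector [vector [1, 0, 0, 0],
                  vector [0, 0, 0, 0],
                  vector [0, 0, 0, 0],
                  vector [0, 0, 0, -1]]"

definition ad_eigenspace :: "form \<Rightarrow> real \<Rightarrow> (real^4^4) set" where
  "ad_eigenspace F \<mu> = {x \<in> rrep F. amat ** x - x ** amat = \<mu> *\<^sub>R x}"

text \<open>The sum of the eigenspaces for the eigenvalues \<open>\<mu> \<ge> \<nu>\<close>. Reals that are not eigenvalues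
  contribute only \<open>0\<close> to the span.\<close>

definition rrep_ge :: "form \<Rightarrow> real \<Rightarrow> (real^4^4) set" where
  "rrep_ge F \<nu> = span (\<Union>\<mu>\<in>{\<nu>..}. ad_eigenspace F \<mu>)"

text \<open>Orthogonal projection onto a linear subspace \<open>S\<close>. The inner product of \<^typ>\<open>real^4^4\<close> is
  the sum of the products of corresponding entries.\<close>

definition orth_proj :: "'a::euclidean_space set \<Rightarrow> 'a \<Rightarrow> 'a" where
  "orth_proj S x = (THE y. y \<in> S \<and> (\<forall>z\<in>S. orthogonal (x - y) z))"

definition proj_u :: "form \<Rightarrow> real \<Rightarrow> real^4^4 \<Rightarrow> real^4^4 \<Rightarrow> real^4^4" where
  "proj_u F \<nu> u = orth_proj (rrep_ge F \<nu>) \<circ> Ad u"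


section \<open>Covering numbers and the exceptional set\<close>

text \<open>The least number of closed max norm balls of radius \<open>\<delta>\<close>, with centres anywhere in the
  ambient space, that cover \<open>S\<close>. Meaningful for bounded \<open>S\<close> and \<open>\<delta> > 0\<close>, where finite covers
  exist.\<close>

definition covering_number :: "real \<Rightarrow> 'a::euclidean_space set \<Rightarrow> nat" where
  "covering_number \<delta> S =
     (LEAST n. \<exists>C. finite C \<and> card C = n \<and> S \<subseteq> (\<Union>c\<in>C. {x. infnorm (x - c) \<le> \<delta>}))"

definition exceptional_set ::
    "form \<Rightarrow> real \<Rightarrow> real \<Rightarrow> real \<Rightarrow> (real^4^4) set \<Rightarrow> (real^4^4) set" where
  "exceptional_set F M \<epsilon> \<delta> A =
     {u \<in> ubox F. \<exists>A'\<subseteq>A.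
        real (covering_number \<delta> A') \<ge> \<delta> powr \<epsilon> * real (covering_number \<delta> A) \<and>
        real (covering_number \<delta> (proj_u F 1 u ` A'))
          < \<delta> powr (M * \<epsilon>) * real (covering_number \<delta> A) powr (3 / 9)}"

end

theory Submission
  imports Defs
begin

text \<open>
  Write \<open>J\<close> for the matrix of the form, scaled so that \<open>J\<^sup>2 = 1\<close>. An element \<open>x\<close> of the
  representation is the same as the symmetric matrix \<open>S = x J\<close>, normalised within its class modulo
  multiples of \<open>J\<close> by the trace condition. For a parameter \<open>p = (r, s)\<close> let \<open>v\<^sub>p\<close> be the first row
  of the unipotent matrix with this parameter; these vectors lie on the null cone, and up to sign
  and scale the form takes on \<open>v\<^sub>p, v\<^sub>q\<close> the value \<open>N(q - p)\<close> with \<open>N(r, s)\<close> equal to \<open>r s\<close> or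
  \<open>(r\<^sup>2 + s\<^sup>2) / 2\<close>. The projection attached to \<open>p\<close> amounts to the functional \<open>S(v\<^sub>p, w)\<close> of \<open>w\<close>
  in the three-dimensional orthogonal complement of \<open>v\<^sub>p\<close> for the form.

  Put \<open>e(p, q) = S(v\<^sub>p, v\<^sub>q) / N(q - p)\<close>. This is symmetric in \<open>p\<close> and \<open>q\<close>, and a difference \<open>e(p,
  q) - e(p, q')\<close> is seen by the projection at \<open>p\<close>. For a triangle \<open>p, q, r\<close> the number \<open>z = e(q,
  r) - e(q, p)\<close> is therefore seen by the projection at \<open>q\<close>; but it is also \<open>(e(r, q) - e(r, p)) +
  (e(p, r) - e(p, q))\<close>, which is seen by the projections at \<open>p\<close> and \<open>r\<close> together. This coincidence
  is why three projections, of total rank nine, never determine \<open>x\<close>: in the generic case a line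
  remains undetermined, spanned by the square of the linear functional that vanishes at \<open>v\<^sub>p, v\<^sub>q,
  v\<^sub>r\<close>. It is also the gain that compensates the loss. Take five parameters \<open>0, 1, 2, 3, 4\<close> and
  the two triangles \<open>0 1 2\<close> and \<open>0 3 4\<close>, with shared numbers \<open>z\<close> and \<open>z'\<close>. For generic parameters
  the number \<open>z'\<close> is nonzero on the line left undetermined by the first triangle, and conversely.
  If \<open>x\<close> is uniformly distributed on a finite set and \<open>H\<close> denotes entropy at scale \<open>\<delta>\<close>,
  submodularity gives, up to constants, \<open>H(x) + H(z) \<le> H\<^sub>0 + H\<^sub>1 + H\<^sub>2 + H(z')\<close> and \<open>H(x) + H(z')
  \<le> H\<^sub>0 + H\<^sub>3 + H\<^sub>4 + H(z)\<close>, where \<open>H\<^sub>i\<close> is the entropy of the \<open>i\<close>-th projection. In the sum of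
  the two the auxiliary numbers cancel, and \<open>2 H(x) \<le> 2 H\<^sub>0 + H\<^sub>1 + H\<^sub>2 + H\<^sub>3 + H\<^sub>4\<close>. Six
  entropies bound twice the entropy of \<open>x\<close>, which is the exponent one third of the theorem. Lemmas
  \<open>entropy_triple_exchange\<close>, \<open>separation\<close> and \<open>five_projections\<close> carry this part.

  It remains to find five exceptional parameters that are quantitatively generic and whose large
  subsets \<open>A'\<close> have a large intersection. The genericity conditions say that certain quadratic
  polynomials are not too small at the next parameter. A sublevel set of such a polynomial has
  small Haar measure, because suitable translates of it overlap at most twice
  (\<open>quad_sublevel_measure\<close>). Hence, from an exceptional set of outer measure more than \<open>t = \<delta> powr
  \<epsilon>\<close>, one chooses greedily about \<open>1 / t\<close> parameters, every increasing tuple of which is generic up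
  to a fixed power of \<open>t\<close> (\<open>generic_sequence\<close>). Each corresponding subset has density at least \<open>t\<close>
  up to a constant, so by pigeonhole five of them share a proportion of \<open>A\<close> that is a fixed power
  of \<open>t\<close> (\<open>popular_five\<close>). All losses being powers of \<open>t\<close>, a large enough \<open>M\<close> contradicts the
  inequality for five projections; counting the powers shows that \<open>723\<close> suffices.
\<close>


section \<open>Entropy of functions on a finite set\<close>

definition fibre_card :: "'a set \<Rightarrow> ('a \<Rightarrow> 'b) \<Rightarrow> 'a \<Rightarrow> nat" where
  "fibre_card A f x = card {y \<in> A. f y = f x}"

text \<open>The Shannon entropy of \<open>f x\<close> for \<open>x\<close> uniform on \<open>A\<close>, multiplied by the cardinality of \<open>A\<close>;
  in this normalisation all inequalities are between sums over \<open>A\<close>.\<close>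

definition entropy :: "'a set \<Rightarrow> ('a \<Rightarrow> 'b) \<Rightarrow> real" where
  "entropy A f = (\<Sum>x\<in>A. ln (real (card A) / real (fibre_card A f x)))"

lemma fibre_card_pos: "finite A \<Longrightarrow> x \<in> A \<Longrightarrow> 0 < fibre_card A f x"
  unfolding fibre_card_def by (subst card_gt_0_iff) auto

lemma sum_inverse_fibre_card:
  assumes "finite A"
  shows "(\<Sum>x\<in>A. h (f x) / real (fibre_card A f x)) = (\<Sum>b\<in>f ` A. h b)"
proof -
  have "(\<Sum>x\<in>A. h (f x) / real (fibre_card A f x)) = (\<Sum>b\<in>f ` A. \<Sum>x\<in>{x\<in>A. f x
      = b}. h (f x) / real (fibre_card A f x))"
    using sum.group[of A "f ` A" f "\<lambda>x. h (f x) / real (fibre_card A f x)"] assms by simp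
  also have "\<dots> = (\<Sum>b\<in>f ` A. h b)"
  proof (rule sum.cong[OF refl])
    fix b assume "b \<in> f ` A"
    then obtain x0 where x0: "x0 \<in> A" "f x0 = b" by auto
    have "card {x \<in> A. f x = b} > 0" using x0 assms by (subst card_gt_0_iff) auto
    moreover have "(\<Sum>x\<in>{x\<in>A. f x = b}. h (f x) / real (fibre_card A f x))
        = (\<Sum>x\<in>{x\<in>A. f x = b}. h b / real (card {x \<in> A. f x = b}))"
      by (rule sum.cong) (auto simp: fibre_card_def)
    ultimately show "(\<Sum>x\<in>{x\<in>A. f x = b}. h (f x) / real (fibre_card A f x)) = h b" by simp
  qed
  finally show ?thesis .
qed

text \<open>All entropy inequalities below have the form \<open>\<Sum> ln t \<le> 0\<close> for an explicit ratio \<open>t\<close> of fibre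
  sizes. Since \<open>ln t \<le> t - 1\<close>, they reduce to counting identities for \<open>\<Sum> t\<close>.\<close>

lemma gibbs:
  assumes "finite A" "\<And>x. x \<in> A \<Longrightarrow> 0 < t x" "(\<Sum>x\<in>A. t x) \<le> real (card A)"
  shows "(\<Sum>x\<in>A. ln (t x)) \<le> (0::real)"
proof -
  have "(\<Sum>x\<in>A. ln (t x)) \<le> (\<Sum>x\<in>A. t x - 1)"
    by (intro sum_mono ln_le_minus_one assms)
  with assms show ?thesis by (simp add: sum_subtractf)
qed

text \<open>For a value \<open>c\<close> of \<open>z\<close>, the pairs of values of \<open>f\<close> and \<open>g\<close> that occur over \<open>c\<close> form a subset
  of a product. Enlarging the sum of the ratios to the whole product can only increase it, and
  there it factorises and totals to the size of the fibre of \<open>c\<close>.\<close>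

lemma entropy_submodular:
  assumes A: "finite A"
  shows "entropy A (\<lambda>x. (f x, g x, z x)) + entropy A z
    \<le> entropy A (\<lambda>x. (f x, z x)) + entropy A (\<lambda>x. (g x, z x))"
proof -
  let ?a = "\<lambda>x. (f x, z x)" and ?b = "\<lambda>x. (g x, z x)" and ?ab = "\<lambda>x. (f x, g x, z x)"
  define t where "t x = real (fibre_card A ?a x) * real (fibre_card A ?b x)
     / (real (fibre_card A ?ab x) * real (fibre_card A z x))" for x
  have pos: "0 < real (fibre_card A q x)" if "x \<in> A" for q :: "'a \<Rightarrow> 'q" and x
    using fibre_card_pos[OF A that, of q] by simp
  have "(\<Sum>x\<in>A. t x) \<le> real (card A)"
  proof -
    define fib where "fib c = {y\<in>A. z y = c}" for c
    define na where "na u c = card {y\<in>A. f y = u \<and> z y = c}" for u c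
    define nb where "nb v c = card {y\<in>A. g y = v \<and> z y = c}" for v c
    \<comment> \<open>the product of the numbers of points over the two values, relative to the size of the fibre\<close>
    define h where "h = (\<lambda>(u, v, c). real (na u c) * real (nb v c) / real (card (fib c)))"
    have "(\<Sum>x\<in>A. t x) = (\<Sum>x\<in>A. h (?ab x) / real (fibre_card A ?ab x))"
      by (rule sum.cong) (auto simp: t_def h_def na_def nb_def fib_def fibre_card_def field_simps)
    also have "\<dots> = (\<Sum>b\<in>?ab ` A. h b)" by (rule sum_inverse_fibre_card[OF A])
    also have "\<dots> \<le> (\<Sum>b\<in>(\<lambda>(c,u,v). (u,v,c)) ` (SIGMA c:z ` A. f ` fib c \<times> g ` fib c). h b)"
    proof (rule sum_mono2)
      show "finite ((\<lambda>(c,u,v). (u,v,c)) ` (SIGMA c:z ` A. f ` fib c \<times> g ` fib c))"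
        using A by (intro finite_imageI finite_SigmaI) (auto simp: fib_def)
      show "?ab ` A \<subseteq> (\<lambda>(c,u,v). (u,v,c)) ` (SIGMA c:z ` A. f ` fib c \<times> g ` fib c)"
      proof
        fix b assume "b \<in> ?ab ` A"
        then obtain x where x: "x \<in> A" "b = ?ab x" by auto
        have "(z x, f x, g x) \<in> (SIGMA c:z ` A. f ` fib c \<times> g ` fib c)"
          using x by (auto simp: fib_def)
        with x show "b \<in> (\<lambda>(c,u,v). (u,v,c)) ` (SIGMA c:z ` A. f ` fib c \<times> g ` fib c)"
          by (intro image_eqI[where x = "(z x, f x, g x)"]) auto
      qed
    qed (auto simp: h_def)
    also have "\<dots> = (\<Sum>b\<in>(SIGMA c:z ` A. f ` fib c \<times> g ` fib c). h ((\<lambda>(c,u,v). (u,v,c)) b))"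
      by (subst sum.reindex) (auto simp: inj_on_def)
    also have "\<dots> = (\<Sum>c\<in>z`A. \<Sum>(u,v)\<in>f ` fib c \<times> g ` fib c. h (u,v,c))"
      using A by (subst sum.Sigma) (auto simp: fib_def split_def)
    also have "\<dots> = (\<Sum>c\<in>z`A. real (card (fib c)))"
    proof (rule sum.cong[OF refl])
      fix c assume c: "c \<in> z ` A"
      have fin: "finite (fib c)" using A by (simp add: fib_def)
      have cpos: "0 < card (fib c)" using c A by (subst card_gt_0_iff) (auto simp: fib_def)
      have sa: "(\<Sum>u\<in>f ` fib c. real (na u c)) = real (card (fib c))"
      proof -
        have "card (fib c) = (\<Sum>u\<in>f ` fib c. card {y \<in> fib c. f y = u})"
          using sum.group[OF fin, of "f ` fib c" f "\<lambda>_. 1::nat"] fin by simp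
        also have "\<dots> = (\<Sum>u\<in>f ` fib c. na u c)"
          by (rule sum.cong) (auto simp: na_def fib_def intro!: arg_cong[of _ _ card])
        finally show ?thesis by simp
      qed
      have sb: "(\<Sum>u\<in>g ` fib c. real (nb u c)) = real (card (fib c))"
      proof -
        have "card (fib c) = (\<Sum>u\<in>g ` fib c. card {y \<in> fib c. g y = u})"
          using sum.group[OF fin, of "g ` fib c" g "\<lambda>_. 1::nat"] fin by simp
        also have "\<dots> = (\<Sum>u\<in>g ` fib c. nb u c)"
          by (rule sum.cong) (auto simp: nb_def fib_def intro!: arg_cong[of _ _ card])
        finally show ?thesis by simp
      qed
      have "(\<Sum>(u,v)\<in>f ` fib c \<times> g ` fib c. h (u,v,c))
          = (\<Sum>u\<in>f ` fib c. \<Sum>v\<in>g ` fib c. real (na u c) * real (nb v c)) / real (card (fib c))"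
        unfolding h_def by (simp add: sum.cartesian_product sum_divide_distrib split_def)
      also have "(\<Sum>u\<in>f ` fib c. \<Sum>v\<in>g ` fib c. real (na u c) * real (nb v c))
          = (\<Sum>u\<in>f ` fib c. real (na u c)) * (\<Sum>v\<in>g ` fib c. real (nb v c))"
        by (simp add: sum_product)
      finally show "(\<Sum>(u,v)\<in>f ` fib c \<times> g ` fib c. h (u,v,c)) = real (card (fib c))"
        unfolding sa sb using cpos by simp
    qed
    also have "\<dots> = real (card A)"
      using sum.group[OF A, of "z ` A" z "\<lambda>_. 1::real"] A by (simp add: fib_def)
    finally show ?thesis .
  qed
  then have "(\<Sum>x\<in>A. ln (t x)) \<le> 0"
    unfolding t_def by (intro gibbs A divide_pos_pos mult_pos_pos pos)
  moreover have "(\<Sum>x\<in>A. ln (t x)) = entropy A ?ab + entropy A z - entropy A ?a - entropy A ?b"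
    unfolding entropy_def sum.distrib[symmetric] sum_subtractf[symmetric]
  proof (rule sum.cong[OF refl])
    fix x assume x: "x \<in> A"
    then have "0 < real (card A)" using A by (auto simp: card_gt_0_iff)
    then show "ln (t x) = ln (real (card A) / real (fibre_card A ?ab x)) + ln (real (card A) / real
        (fibre_card A z x))
      - ln (real (card A) / real (fibre_card A ?a x)) - ln (real (card A) / real (fibre_card A ?b
          x))"
      unfolding t_def using pos[OF x, of ?a] pos[OF x, of ?b] pos[OF x, of ?ab] pos[OF x, of z]
      by (simp add: ln_div ln_mult)
  qed
  ultimately show ?thesis by simp
qed

text \<open>The ratio to be summed is the proportion of the fibre of \<open>f\<close>, and every fibre of \<open>f\<close>
  contributes as many terms as \<open>g\<close> takes values on it, at most \<open>C\<close>.\<close>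

lemma entropy_chain:
  assumes A: "finite A"
    and C: "\<And>x. x \<in> A \<Longrightarrow> card (g ` {y\<in>A. f y = f x}) \<le> C"
  shows "entropy A (\<lambda>x. (f x, g x)) \<le> entropy A f + real (card A) * ln (real C)"
proof (cases "A = {}")
  case True then show ?thesis by (simp add: entropy_def)
next
  case False
  then obtain x0 where x0: "x0 \<in> A" by auto
  have "0 < card (g ` {y\<in>A. f y = f x0})" using A x0 by (subst card_gt_0_iff) auto
  with C[OF x0] have Cpos: "0 < real C" by linarith
  let ?fg = "\<lambda>x. (f x, g x)"
  have pos: "0 < real (fibre_card A q x)" if "x \<in> A" for q :: "'a \<Rightarrow> 'q" and x
    using fibre_card_pos[OF A that, of q] by simp
  define t where "t x = real (fibre_card A f x) / (real (fibre_card A ?fg x) * real C)" for x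
  have "(\<Sum>x\<in>A. t x) \<le> real (card A)"
  proof -
    have "(\<Sum>x\<in>A. t x) = (\<Sum>x\<in>A. (\<lambda>(u,v). real (card {y\<in>A. f y
        = u}) / real C) (?fg x) / real (fibre_card A ?fg x))"
      by (rule sum.cong) (auto simp: t_def fibre_card_def field_simps)
    also have "\<dots> = (\<Sum>(u,v)\<in>?fg ` A. real (card {y\<in>A. f y = u}) / real C)"
      by (rule sum_inverse_fibre_card[OF A])
    also have "?fg ` A = (SIGMA u:f ` A. g ` {y\<in>A. f y = u})"
    proof (intro set_eqI iffI)
      fix b assume "b \<in> (SIGMA u:f ` A. g ` {y\<in>A. f y = u})"
      then obtain y where "y \<in> A" "b = ?fg y" by auto
      then show "b \<in> ?fg ` A" by blast
    qed auto
    also have "(\<Sum>(u,v)\<in>(SIGMA u:f ` A. g ` {y\<in>A. f y = u}). real (card {y\<in>A. f y = u}) / real C)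
       = (\<Sum>u\<in>f ` A. real (card (g ` {y\<in>A. f y = u})) * (real (card {y\<in>A. f y = u}) / real C))"
      using A by (subst sum.Sigma[symmetric]) auto
    also have "\<dots> \<le> (\<Sum>u\<in>f ` A. real (card {y\<in>A. f y = u}))"
    proof (rule sum_mono)
      fix u assume "u \<in> f ` A"
      then have "real (card (g ` {y\<in>A. f y = u})) \<le> real C" using C by auto
      then have "real (card (g ` {y\<in>A. f y = u})) * real (card {y\<in>A. f y
          = u}) \<le> real C * real (card {y\<in>A. f y = u})"
        by (rule mult_right_mono) simp
      then show "real (card (g ` {y\<in>A. f y = u})) * (real (card {y\<in>A. f y
          = u}) / real C) \<le> real (card {y\<in>A. f y = u})"
        using Cpos by (simp add: field_simps)
    qed
    also have "\<dots> = real (card A)"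
      using sum.group[OF A, of "f ` A" f "\<lambda>_. 1::real"] A by simp
    finally show ?thesis .
  qed
  then have "(\<Sum>x\<in>A. ln (t x)) \<le> 0"
    unfolding t_def by (intro gibbs A divide_pos_pos mult_pos_pos pos Cpos)
  moreover have "(\<Sum>x\<in>A. ln (t x)) = entropy A ?fg - (entropy A f + real (card A) * ln (real C))"
  proof -
    have "(\<Sum>x\<in>A. ln (t x)) = (\<Sum>x\<in>A. ln (real (card A) / real (fibre_card A ?fg x))
        - ln (real (card A) / real (fibre_card A f x)) - ln (real C))"
    proof (rule sum.cong[OF refl])
      fix x assume x: "x \<in> A"
      then have "0 < real (card A)" using A by (auto simp: card_gt_0_iff)
      then show "ln (t x) = ln (real (card A) / real (fibre_card A ?fg x))
        - ln (real (card A) / real (fibre_card A f x)) - ln (real C)"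
        unfolding t_def using pos[OF x, of ?fg] pos[OF x, of f] Cpos
        by (simp add: ln_div ln_mult)
    qed
    then show ?thesis unfolding entropy_def sum_subtractf by simp
  qed
  ultimately show ?thesis by simp
qed

lemma entropy_const: "entropy A (\<lambda>_. c) = 0"
  by (cases "finite A") (auto simp: entropy_def fibre_card_def intro!: sum.neutral)

lemma entropy_cong:
  assumes "\<And>x y. x \<in> A \<Longrightarrow> y \<in> A \<Longrightarrow> f x = f y \<longleftrightarrow> g x = g y"
  shows "entropy A f = entropy A g"
  unfolding entropy_def fibre_card_def
  by (intro sum.cong refl arg_cong[of _ _ ln] arg_cong2[of _ _ _ _ "(/)"] arg_cong[of _ _ real]
      arg_cong[of _ _ card]) (use assms in auto)

lemma entropy_le_ln_card:
  assumes "finite A" shows "entropy A f \<le> real (card A) * ln (real (card (f ` A)))"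
  using entropy_chain[OF assms, of f "\<lambda>_. ()" "card (f ` A)"]
    entropy_cong[of A "\<lambda>x. ((), f x)" f] by (simp add: entropy_const)

lemma entropy_mono:
  assumes A: "finite A" and "\<And>x y. x \<in> A \<Longrightarrow> y \<in> A \<Longrightarrow> g x = g y \<Longrightarrow> f x = f y"
  shows "entropy A f \<le> entropy A g"
  unfolding entropy_def
proof (rule sum_mono)
  fix x assume x: "x \<in> A"
  have le: "fibre_card A g x \<le> fibre_card A f x" unfolding fibre_card_def
  proof (rule card_mono)
    show "{y \<in> A. g y = g x} \<subseteq> {y \<in> A. f y = f x}" using x assms(2) by blast
  qed (use A in simp)
  have "0 < card A" using x A by (auto simp: card_gt_0_iff)
  then show "ln (real (card A) / real (fibre_card A f x))
      \<le> ln (real (card A) / real (fibre_card A g x))"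
    using le fibre_card_pos[OF A x, of f] fibre_card_pos[OF A x, of g]
    by (subst ln_le_cancel_iff) (auto simp: frac_le)
qed

lemma entropy_pair: "finite A \<Longrightarrow> entropy A (\<lambda>x. (f x, g x)) \<le> entropy A f + entropy A g"
  using entropy_submodular[of A f g "\<lambda>_. ()"] entropy_cong[of A "\<lambda>x. (f x, g x, ())"
    "\<lambda>x. (f x, g x)"]
    entropy_cong[of A "\<lambda>x. (f x, ())" f] entropy_cong[of A "\<lambda>x. (g x, ())" g]
  by (simp add: entropy_const)

lemma entropy_id: "finite A \<Longrightarrow> entropy A (\<lambda>x. x) = real (card A) * ln (real (card A))"
proof -
  assume A: "finite A"
  have "fibre_card A (\<lambda>x. x) x = 1" if "x \<in> A" for x
  proof -
    have "{y \<in> A. y = x} = {x}" using that by auto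
    then show ?thesis by (simp add: fibre_card_def)
  qed
  then show ?thesis by (simp add: entropy_def)
qed

text \<open>Here \<open>b\<close>, and likewise the pair \<open>(a, c)\<close>, determine \<open>z\<close> up to two values, so \<open>z\<close> is
  information common to both and submodularity saves its entropy. In exchange \<open>(a, b, c)\<close> alone
  may fail to determine the point, and the additional function \<open>w\<close> is paid for.\<close>

lemma entropy_triple_exchange:
  assumes A: "finite A"
    and one: "\<And>x. x \<in> A \<Longrightarrow> card (z ` {y\<in>A. b y = b x}) \<le> 2"
    and two: "\<And>x. x \<in> A \<Longrightarrow> card (z ` {y\<in>A. a y = a x \<and> c y = c x}) \<le> 2"
    and inj: "\<And>x. x \<in> A \<Longrightarrow> card {y\<in>A. a y = a x \<and> c y = c x \<and> b y = b x \<and> w y = w x} \<le> C"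
  shows "entropy A (\<lambda>x. x) + entropy A z \<le> entropy A a + entropy A b + entropy A c + entropy A w
           + real (card A) * (2 * ln 2 + ln (real C))"
proof -
  let ?ac = "\<lambda>x. (a x, c x)"
  let ?all = "\<lambda>x. ((?ac x, b x, z x), w x)"
  have "entropy A (\<lambda>x. x) \<le> entropy A (\<lambda>x. (?all x, x))"
    by (rule entropy_mono[OF A]) auto
  also have "\<dots> \<le> entropy A ?all + real (card A) * ln (real C)"
  proof (rule entropy_chain[OF A])
    fix x assume x: "x \<in> A"
    have "card ((\<lambda>x. x) ` {y \<in> A. ?all y = ?all x}) \<le> card {y\<in>A. a y = a x \<and> c y = c x \<and> b y
        = b x \<and> w y = w x}"
      using A by (intro card_mono) auto
    with inj[OF x] show "card ((\<lambda>x. x) ` {y \<in> A. ?all y = ?all x}) \<le> C" by linarith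
  qed
  finally have 1: "entropy A (\<lambda>x. x) \<le> entropy A ?all + real (card A) * ln (real C)" .
  have 2: "entropy A ?all \<le> entropy A (\<lambda>x. (?ac x, b x, z x)) + entropy A w"
    by (rule entropy_pair[OF A])
  have 3: "entropy A (\<lambda>x. (?ac x, b x, z x)) + entropy A z
      \<le> entropy A (\<lambda>x. (?ac x, z x)) + entropy A (\<lambda>x. (b x, z x))"
    by (rule entropy_submodular[OF A])
  have 4: "entropy A (\<lambda>x. (?ac x, z x)) \<le> entropy A ?ac + real (card A) * ln (real 2)"
    using two by (intro entropy_chain[OF A]) auto
  have 5: "entropy A (\<lambda>x. (b x, z x)) \<le> entropy A b + real (card A) * ln (real 2)"
    using one by (intro entropy_chain[OF A]) auto
  have 6: "entropy A ?ac \<le> entropy A a + entropy A c"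
    by (rule entropy_pair[OF A])
  from 1 2 3 4 5 6 show ?thesis by (simp add: algebra_simps)
qed

section \<open>Cells, covering numbers and popular five-tuples\<close>

text \<open>On average a point of \<open>\<Gamma>\<close> lies in at least eight of the sets, so the points that lie in at
  least five of them make up a proportion of at least \<open>\<theta> / 2\<close>. Each of them is counted by one of
  at most \<open>n^5\<close> five-element sets of indices.\<close>

lemma popular_five:
  fixes S :: "nat \<Rightarrow> 'a set" and \<theta> :: real
  assumes \<Gamma>: "finite \<Gamma>" "\<Gamma> \<noteq> {}" and sub: "\<And>i. i < n \<Longrightarrow> S i \<subseteq> \<Gamma>"
    and dens: "\<And>i. i < n \<Longrightarrow> \<theta> * real (card \<Gamma>) \<le> real (card (S i))"
    and n: "8 \<le> \<theta> * real n" and \<theta>: "0 < \<theta>"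
  shows "\<exists>I. I \<subseteq> {..<n} \<and> card I
      = 5 \<and> \<theta> * real (card \<Gamma>) \<le> 2 * real n^5 * real (card {\<gamma>\<in>\<Gamma>. \<forall>i\<in>I. \<gamma> \<in> S i})"
proof (rule ccontr)
  assume not: "\<not> ?thesis"
  define d where "d \<gamma> = card {i. i < n \<and> \<gamma> \<in> S i}" for \<gamma>
  define T where "T = {\<gamma>\<in>\<Gamma>. 5 \<le> d \<gamma>}"
  define \<I> where "\<I> = {I. I \<subseteq> {..<n} \<and> card I = 5}"
  define G where "G I = {\<gamma>\<in>\<Gamma>. \<forall>i\<in>I. \<gamma> \<in> S i}" for I
  have G\<Gamma>: "0 < real (card \<Gamma>)" using \<Gamma> by (simp add: card_gt_0_iff)
  have npos: "0 < n" using n \<theta> by (cases n) auto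
  have dn: "d \<gamma> \<le> n" for \<gamma>
    unfolding d_def using card_mono[of "{..<n}" "{i. i < n \<and> \<gamma> \<in> S i}"] by auto
  have fT: "finite T" using \<Gamma> by (simp add: T_def)
  have "(\<Sum>i<n. card (S i)) = (\<Sum>\<gamma>\<in>\<Gamma>. d \<gamma>)"
  proof -
    have "(\<Sum>i<n. card (S i)) = (\<Sum>i<n. \<Sum>\<gamma>\<in>\<Gamma>. if \<gamma> \<in> S i then 1 else 0)"
      using sub \<Gamma> by (intro sum.cong refl) (simp add: sum.If_cases Int_absorb1)
    also have "\<dots> = (\<Sum>\<gamma>\<in>\<Gamma>. \<Sum>i<n. if \<gamma> \<in> S i then 1 else 0)" by (rule sum.swap)
    also have "\<dots> = (\<Sum>\<gamma>\<in>\<Gamma>. d \<gamma>)"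
      by (intro sum.cong refl) (simp add: d_def sum.If_cases Int_def)
    finally show ?thesis .
  qed
  also have "\<dots> \<le> (\<Sum>\<gamma>\<in>\<Gamma>. 4 + (if \<gamma> \<in> T then n else 0))"
    using dn by (intro sum_mono) (auto simp: T_def intro: trans_le_add2)
  also have "\<dots> = 4 * card \<Gamma> + n * card T"
  proof -
    have "\<Gamma> \<inter> T = T" by (auto simp: T_def)
    then show ?thesis using \<Gamma> by (simp add: sum.distrib sum.If_cases)
  qed
  finally have "real (\<Sum>i<n. card (S i)) \<le> real (4 * card \<Gamma> + n * card T)"
    by (simp only: of_nat_le_iff)
  then have "(\<Sum>i<n. real (card (S i))) \<le> 4 * real (card \<Gamma>) + real n * real (card T)" by simp
  moreover have "real n * (\<theta> * real (card \<Gamma>)) \<le> (\<Sum>i<n. real (card (S i)))"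
    using sum_mono[of "{..<n}" "\<lambda>_. \<theta> * real (card \<Gamma>)" "\<lambda>i. real (card (S i))"] dens by simp
  moreover have "8 * real (card \<Gamma>) \<le> \<theta> * real n * real (card \<Gamma>)"
    by (rule mult_right_mono[OF n]) simp
  ultimately have "real n * (\<theta> * real (card \<Gamma>)) \<le> real n * (2 * real (card T))"
    by (simp add: algebra_simps)
  then have T: "\<theta> * real (card \<Gamma>) \<le> 2 * real (card T)" using npos by simp
  have f\<I>: "finite \<I>" unfolding \<I>_def by (rule finite_subset[of _ "Pow {..<n}"]) auto
  have "T \<subseteq> (\<Union>I\<in>\<I>. G I)"
  proof
    fix \<gamma> assume \<gamma>: "\<gamma> \<in> T"
    then have "5 \<le> card {i. i < n \<and> \<gamma> \<in> S i}" by (simp add: T_def d_def)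
    then obtain I where "I \<subseteq> {i. i < n \<and> \<gamma> \<in> S i}" "card I = 5"
      by (meson obtain_subset_with_card_n)
    with \<gamma> show "\<gamma> \<in> (\<Union>I\<in>\<I>. G I)" by (intro UN_I[of I]) (auto simp: \<I>_def G_def T_def)
  qed
  then have "card T \<le> card (\<Union>I\<in>\<I>. G I)"
    using f\<I> \<Gamma> by (intro card_mono) (auto simp: G_def)
  also have "\<dots> \<le> (\<Sum>I\<in>\<I>. card (G I))" by (rule card_UN_le[OF f\<I>])
  finally have TG: "real (card T) \<le> (\<Sum>I\<in>\<I>. real (card (G I)))"
    unfolding of_nat_sum[symmetric] by (simp only: of_nat_le_iff)
  have cT: "0 < real (card T)" using T \<theta> G\<Gamma> mult_pos_pos[OF \<theta> G\<Gamma>] by linarith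
  have ne: "\<I> \<noteq> {}" using TG cT by auto
  have "2 * real n^5 * real (card T) \<le> (\<Sum>I\<in>\<I>. 2 * real n^5 * real (card (G I)))"
    using mult_left_mono[OF TG, of "2 * real n^5"] by (simp add: sum_distrib_left)
  also have "\<dots> < (\<Sum>I\<in>\<I>. \<theta> * real (card \<Gamma>))"
    using not by (intro sum_strict_mono f\<I> ne) (auto simp: \<I>_def G_def not_le)
  also have "\<dots> = real (card \<I>) * (\<theta> * real (card \<Gamma>))" by simp
  also have "\<dots> \<le> real n^5 * (\<theta> * real (card \<Gamma>))"
  proof (rule mult_right_mono)
    have "card \<I> = n choose 5" unfolding \<I>_def by (subst n_subsets) auto
    moreover have "5 \<le> n"
    proof -
      obtain I where "I \<subseteq> {..<n}" "card I = 5" using ne by (auto simp: \<I>_def)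
      then show ?thesis using card_mono[of "{..<n}" I] by simp
    qed
    ultimately have "card \<I> \<le> n^5" by (simp add: binomial_le_pow)
    then show "real (card \<I>) \<le> real n^5" by (metis of_nat_le_iff of_nat_power)
  qed (use \<theta> in auto)
  finally have "real n^5 * (2 * real (card T)) < real n^5 * (\<theta> * real (card \<Gamma>))"
    by (simp add: algebra_simps)
  then have "2 * real (card T) < \<theta> * real (card \<Gamma>)" using npos by (simp add: mult_less_cancel_left)
  with T show False by simp
qed

text \<open>The half-open grid cube of side \<open>\<delta>\<close> that contains \<open>x\<close>. Unlike covering numbers, sets of
  cells can be intersected and counted exactly, which is what the pigeonhole argument needs.\<close>

definition cell :: "real \<Rightarrow> 'a::euclidean_space \<Rightarrow> 'a \<Rightarrow> int" where
  "cell \<delta> x = (\<lambda>b\<in>Basis. \<lfloor>x \<bullet> b / \<delta>\<rfloor>)"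

lemma infnorm_le_iff: "infnorm (x::'a::euclidean_space) \<le> c \<longleftrightarrow> (\<forall>b\<in>Basis. \<bar>x \<bullet> b\<bar> \<le> c)"
  unfolding infnorm_Max by (subst Max_le_iff) auto

lemma cell_eq_imp:
  assumes "0 < \<delta>" "cell \<delta> x = cell \<delta> y"
  shows "infnorm (x - y) \<le> \<delta>"
  unfolding infnorm_le_iff
proof
  fix b :: 'a assume b: "b \<in> Basis"
  have "\<lfloor>x \<bullet> b / \<delta>\<rfloor> = \<lfloor>y \<bullet> b / \<delta>\<rfloor>"
    using fun_cong[OF assms(2), of b] b by (simp add: cell_def)
  then have "\<bar>x \<bullet> b / \<delta> - y \<bullet> b / \<delta>\<bar> \<le> 1" by linarith
  then have "\<bar>(x - y) \<bullet> b\<bar> / \<delta> \<le> 1"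
    using assms(1) by (simp add: inner_diff_left diff_divide_distrib[symmetric] abs_divide)
  then show "\<bar>(x - y) \<bullet> b\<bar> \<le> \<delta>" using assms(1) by (simp add: field_simps)
qed

lemma cells_of_small_set:
  fixes S :: "'a::euclidean_space set"
  assumes "0 < \<delta>" "0 \<le> R" and S: "\<And>x y. x \<in> S \<Longrightarrow> y \<in> S \<Longrightarrow> infnorm (x - y) \<le> R"
  shows "finite (cell \<delta> ` S)" "real (card (cell \<delta> ` S)) \<le> (2 * R / \<delta> + 2) ^ DIM('a)"
proof -
  have "finite (cell \<delta> ` S) \<and> real (card (cell \<delta> ` S)) \<le> (2 * R / \<delta> + 2) ^ DIM('a)"
  proof (cases "S = {}")
    case True
    then show ?thesis using assms by simp
  next
    case False
    then obtain x0 where x0: "x0 \<in> S" by auto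
    define J where "J b = {\<lfloor>(x0 \<bullet> b - R) / \<delta>\<rfloor>..\<lfloor>(x0 \<bullet> b + R) / \<delta>\<rfloor>}" for b
    have sub: "cell \<delta> ` S \<subseteq> PiE Basis J"
    proof
      fix g assume "g \<in> cell \<delta> ` S"
      then obtain x where x: "x \<in> S" "g = cell \<delta> x" by auto
      have "x0 \<bullet> b - R \<le> x \<bullet> b \<and> x \<bullet> b \<le> x0 \<bullet> b + R" if "b \<in> Basis" for b
        using S[OF x(1) x0] that
          by (auto simp: infnorm_le_iff inner_diff_left abs_le_iff dest!: bspec[OF _ that])
      then show "g \<in> PiE Basis J"
        using assms(1) by (auto simp: x cell_def J_def intro!: floor_mono divide_right_mono)
    qed
    have cJ: "real (card (J b)) \<le> 2 * R / \<delta> + 2" for b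
    proof -
      have "(x0 \<bullet> b + R) / \<delta> - (x0 \<bullet> b - R) / \<delta> = 2 * R / \<delta>"
        by (simp add: diff_divide_distrib[symmetric])
      moreover have "0 \<le> 2 * R / \<delta>" using assms by simp
      ultimately show ?thesis by (simp add: J_def) linarith
    qed
    have fin: "finite (PiE Basis J)" by (intro finite_PiE) (auto simp: J_def)
    have "real (card (cell \<delta> ` S)) \<le> real (card (PiE Basis J))"
      using card_mono[OF fin sub] by simp
    also have "\<dots> = (\<Prod>b\<in>Basis. real (card (J b)))" by (simp add: card_PiE)
    also have "\<dots> \<le> (\<Prod>b\<in>(Basis::'a set). 2 * R / \<delta> + 2)" by (intro prod_mono) (simp add: cJ)
    finally show ?thesis using finite_subset[OF sub fin] by simp
  qed
  then show "finite (cell \<delta> ` S)" "real (card (cell \<delta> ` S)) \<le> (2 * R / \<delta> + 2) ^ DIM('a)" by auto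
qed

lemma covering_number_attained:
  fixes S :: "'a::euclidean_space set"
  assumes \<delta>: "0 < \<delta>" and S: "\<And>x. x \<in> S \<Longrightarrow> infnorm x \<le> R"
  shows "\<exists>C. finite C \<and> card C = covering_number \<delta> S \<and> S \<subseteq> (\<Union>c\<in>C. {x. infnorm (x - c) \<le> \<delta>})"
    and "covering_number \<delta> S \<le> card (cell \<delta> ` S)"
proof -
  let ?P = "\<lambda>n. \<exists>C. finite C \<and> card C = n \<and> S \<subseteq> (\<Union>c\<in>C. {x. infnorm (x - c) \<le> \<delta>})"
  have fin: "finite (cell \<delta> ` S)"
  proof (rule cells_of_small_set(1)[OF \<delta>, of "\<bar>2 * R\<bar>"])
    fix x y assume "x \<in> S" "y \<in> S"
    with S[of x] S[of y] infnorm_triangle[of x "- y"] show "infnorm (x - y) \<le> \<bar>2 * R\<bar>"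
      by (simp add: infnorm_neg)
  qed simp
  \<comment> \<open>one ball around a point of each occupied cell\<close>
  define rep where "rep g = (SOME x. x \<in> S \<and> cell \<delta> x = g)" for g
  have rep: "rep (cell \<delta> x) \<in> S \<and> cell \<delta> (rep (cell \<delta> x)) = cell \<delta> x" if "x \<in> S" for x
    unfolding rep_def by (rule someI[of _ x]) (use that in simp)
  let ?C = "rep ` cell \<delta> ` S"
  have "S \<subseteq> (\<Union>c\<in>?C. {x. infnorm (x - c) \<le> \<delta>})"
  proof
    fix x assume x: "x \<in> S"
    then have "infnorm (x - rep (cell \<delta> x)) \<le> \<delta>" using rep[OF x] by (intro cell_eq_imp[OF \<delta>]) simp
    with x show "x \<in> (\<Union>c\<in>?C. {x. infnorm (x - c) \<le> \<delta>})" by auto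
  qed
  with fin have P: "?P (card ?C)" by blast
  show "?P (covering_number \<delta> S)" unfolding covering_number_def by (rule LeastI[of ?P, OF P])
  have "covering_number \<delta> S \<le> card ?C" unfolding covering_number_def by (rule Least_le[of ?P, OF P])
  also have "\<dots> \<le> card (cell \<delta> ` S)" by (rule card_image_le[OF fin])
  finally show "covering_number \<delta> S \<le> card (cell \<delta> ` S)" .
qed

text \<open>A closed ball of radius \<open>\<delta>\<close> has diameter at most \<open>2 \<delta>\<close> and meets at most six layers of cells
  in each coordinate direction.\<close>

lemma cells_le_covering_number:
  fixes S :: "'a::euclidean_space set"
  assumes \<delta>: "0 < \<delta>" and S: "\<And>x. x \<in> S \<Longrightarrow> infnorm x \<le> R"
  shows "finite (cell \<delta> ` S)" "real (card (cell \<delta> ` S)) \<le> 6 ^ DIM('a) * real (covering_number \<delta> S)"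
proof -
  obtain C where C: "finite C" "card C = covering_number \<delta> S" "S \<subseteq> (\<Union>c\<in>C. {x. infnorm (x - c) \<le> \<delta>})"
    using covering_number_attained(1)[OF assms] by blast
  define B where "B c = cell \<delta> ` {x. infnorm (x - c) \<le> \<delta>}" for c :: 'a
  have B: "finite (B c)" "real (card (B c)) \<le> 6 ^ DIM('a)" for c
  proof -
    have d: "infnorm (x - y) \<le> 2 * \<delta>" if "infnorm (x - c) \<le> \<delta>" "infnorm (y - c) \<le> \<delta>" for x y
      using infnorm_triangle[of "x - c" "c - y"] that by (simp add: infnorm_sub[of c y])
    show "finite (B c)"
      unfolding B_def using \<delta> d by (intro cells_of_small_set(1)[where R = "2 * \<delta>"]) auto
    have "real (card (B c)) \<le> (2 * (2 * \<delta>) / \<delta> + 2) ^ DIM('a)"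
      unfolding B_def using \<delta> d by (intro cells_of_small_set(2)) auto
    then show "real (card (B c)) \<le> 6 ^ DIM('a)" using \<delta> by simp
  qed
  have sub: "cell \<delta> ` S \<subseteq> (\<Union>c\<in>C. B c)" using C(3) unfolding B_def by blast
  then show "finite (cell \<delta> ` S)" by (rule finite_subset) (use C B in auto)
  have "card (cell \<delta> ` S) \<le> card (\<Union>c\<in>C. B c)" using sub C B by (intro card_mono) auto
  also have "\<dots> \<le> (\<Sum>c\<in>C. card (B c))" by (rule card_UN_le[OF C(1)])
  finally have "real (card (cell \<delta> ` S)) \<le> (\<Sum>c\<in>C. real (card (B c)))"
    unfolding of_nat_sum[symmetric] by (simp only: of_nat_le_iff)
  also have "\<dots> \<le> (\<Sum>c\<in>C. 6 ^ DIM('a))" by (intro sum_mono B)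
  finally show "real (card (cell \<delta> ` S)) \<le> 6 ^ DIM('a) * real (covering_number \<delta> S)"
    using C(2) by (simp add: mult.commute)
qed


section \<open>The unipotent group and the representation\<close>

lemma vector_4 [simp]:
  "(vector [a, b, c, d] :: 'a::zero^4) $ 1 = a"
  "(vector [a, b, c, d] :: 'a::zero^4) $ 2 = b"
  "(vector [a, b, c, d] :: 'a::zero^4) $ 3 = c"
  "(vector [a, b, c, d] :: 'a::zero^4) $ 4 = d"
  unfolding vector_def by simp_all

text \<open>The form at the vectors \<open>v\<^sub>p\<close> and \<open>v\<^sub>q\<close> equals the value of this binary form at \<open>q - p\<close>, up
  to sign and scale.\<close>

definition nform :: "form \<Rightarrow> real \<times> real \<Rightarrow> real" where
  "nform F p = (case F of Form22 \<Rightarrow> fst p * snd p | Form31 \<Rightarrow> ((fst p)\<^sup>2 + (snd p)\<^sup>2) / 2)"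

definition unip :: "form \<Rightarrow> real \<times> real \<Rightarrow> real^4^4" where
  "unip F p = umat F (fst p) (snd p)"

text \<open>The first row of the unipotent matrix, a point of the null cone.\<close>

definition cone_point :: "form \<Rightarrow> real \<times> real \<Rightarrow> real^4" where
  "cone_point F p = vector [1, fst p, snd p, nform F p]"

text \<open>The matrix of the form, scaled so as to be an involution for both forms.\<close>

definition jmat :: "form \<Rightarrow> real^4^4" where
  "jmat F = (case F of
      Form22 \<Rightarrow> vector [vector [0, 0, 0, -1], vector [0, 0, 1, 0], vector [0, 1, 0, 0], vector [-1,
          0, 0, 0]]
    | Form31 \<Rightarrow> vector [vector [0, 0, 0, -1], vector [0, 1, 0, 0], vector [0, 0, 1, 0], vector [-1,
        0, 0, 0]])"

lemmas mat4 = vec_eq_iff forall_4 sum_4 matrix_matrix_mult_def mat_def transpose_def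

lemma unip_mult: "unip F p ** unip F q = unip F (p + q)"
  by (cases F) (simp_all add: unip_def mat4 algebra_simps power2_eq_square add_divide_distrib)

lemma unip_0: "unip F 0 = mat 1"
  by (cases F) (simp_all add: unip_def mat4)

lemma matrix_inv_unique:
  fixes A B :: "'a::comm_ring_1^'n^'n"
  assumes "A ** B = mat 1" "B ** A = mat 1"
  shows "matrix_inv A = B"
proof -
  have "A ** matrix_inv A = mat 1 \<and> matrix_inv A ** A = mat 1"
    unfolding matrix_inv_def by (rule someI[of _ B]) (use assms in simp)
  then show ?thesis
    by (metis assms(2) matrix_mul_assoc matrix_mul_lid matrix_mul_rid)
qed

lemma matrix_inv_unip: "matrix_inv (unip F p) = unip F (- p)"
  by (rule matrix_inv_unique) (simp_all add: unip_mult unip_0)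

lemma Ad_unip: "Ad (unip F p) x = unip F p ** x ** unip F (- p)"
  by (simp add: Ad_def matrix_inv_unip)

lemma jmat_sq: "jmat F ** jmat F = mat 1"
  by (cases F) (simp_all add: jmat_def mat4)

lemma qmat_jmat: "qmat F = (case F of Form22 \<Rightarrow> 1/2 | Form31 \<Rightarrow> 1) *\<^sub>R jmat F"
  by (cases F) (simp_all add: qmat_def jmat_def mat4 axis_def)

lemma matrix_inv_qmat: "matrix_inv (qmat F) = (case F of Form22 \<Rightarrow> 2 | Form31 \<Rightarrow> 1) *\<^sub>R jmat F"
  by (rule matrix_inv_unique)
    (cases F; simp add: qmat_jmat scalar_matrix_assoc[symmetric] matrix_scalar_ac jmat_sq)+

lemma transpose_jmat: "transpose (jmat F) = jmat F"
  by (cases F) (simp_all add: jmat_def mat4)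

lemma rrep_iff: "x \<in> rrep F \<longleftrightarrow> trace x = 0 \<and> jmat F ** transpose x ** jmat F = x"
  unfolding rrep_def matrix_inv_qmat unfolding qmat_jmat
  by (cases F) (simp_all add: scalar_matrix_assoc[symmetric] matrix_scalar_ac)

lemma unip_jmat: "jmat F ** transpose (unip F p) = unip F (- p) ** jmat F"
  by (cases F) (simp_all add: unip_def jmat_def mat4 algebra_simps power2_eq_square)

lemma jmat_unip: "transpose (unip F p) ** jmat F = jmat F ** unip F (- p)"
  by (cases F) (simp_all add: unip_def jmat_def mat4 field_simps power2_eq_square)

section \<open>Haar measure of sublevel sets of quadratic polynomials\<close>

text \<open>Written as a combination of constant matrices, the matrix is visibly continuous in the
  parameter.\<close>

lemma unip_affine: "\<exists>E1 E2 E3. \<forall>p. unip F p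
    = mat 1 + fst p *\<^sub>R E1 + snd p *\<^sub>R E2 + nform F p *\<^sub>R E3"
proof (cases F)
  case Form22
  show ?thesis
    by (rule exI[of _ "vector [vector [0,1,0,0], vector [0,0,0,0], vector [0,0,0,1], vector
        [0,0,0,0]]"],
        rule exI[of _ "vector [vector [0,0,1,0], vector [0,0,0,1], vector [0,0,0,0], vector
            [0,0,0,0]]"],
        rule exI[of _ "vector [vector [0,0,0,1], vector [0,0,0,0], vector [0,0,0,0], vector
            [0,0,0,0]]"])
      (simp add: Form22 unip_def nform_def mat4)
next
  case Form31
  show ?thesis
    by (rule exI[of _ "vector [vector [0,1,0,0], vector [0,0,0,1], vector [0,0,0,0], vector
        [0,0,0,0]]"],
        rule exI[of _ "vector [vector [0,0,1,0], vector [0,0,0,0], vector [0,0,0,1], vector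
            [0,0,0,0]]"],
        rule exI[of _ "vector [vector [0,0,0,1], vector [0,0,0,0], vector [0,0,0,0], vector
            [0,0,0,0]]"])
      (simp add: Form31 unip_def nform_def mat4)
qed

lemma continuous_on_nform [continuous_intros]:
  "continuous_on S f \<Longrightarrow> continuous_on S (\<lambda>x. nform F (f x))"
  by (cases F) (auto simp: nform_def intro!: continuous_intros)

lemma continuous_on_unip: "continuous_on S (unip F)"
proof -
  obtain E1 E2 E3 where "\<And>p. unip F p = mat 1 + fst p *\<^sub>R E1 + snd p *\<^sub>R E2 + nform F p *\<^sub>R E3"
    using unip_affine[of F] by blast
  then show ?thesis by (subst continuous_on_cong[OF refl]) (assumption, intro continuous_intros)
qed

lemma unip_inj: "unip F p = unip F q \<longleftrightarrow> p = q"
proof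
  assume "unip F p = unip F q"
  then have "unip F p $ 1 $ 2 = unip F q $ 1 $ 2" "unip F p $ 1 $ 3 = unip F q $ 1 $ 3" by simp_all
  then show "p = q" by (cases F) (simp_all add: unip_def prod_eq_iff)
qed simp

lemma unip_in_ugroup: "unip F p \<in> ugroup F"
  by (auto simp: ugroup_def unip_def)

lemma haar_compact:
  assumes "haar_measure_on (ugroup F) m" "compact K"
  shows "unip F ` K \<in> sets m" "emeasure m (unip F ` K) < \<infinity>"
proof -
  have c: "compact (unip F ` K)"
    using assms(2) continuous_on_unip by (rule compact_continuous_image[rotated])
  have sub: "unip F ` K \<subseteq> ugroup F" using unip_in_ugroup by auto
  have "unip F ` K \<in> sets (restrict_space borel (ugroup F))"
    unfolding sets_restrict_space
      using c sub by (intro image_eqI[of _ _ "unip F ` K"]) (auto intro: borel_compact)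
  then show "unip F ` K \<in> sets m" using assms(1) by (simp add: haar_measure_on_def)
  show "emeasure m (unip F ` K) < \<infinity>"
    using assms(1) c sub by (auto simp: haar_measure_on_def)
qed

lemma haar_translate:
  assumes "haar_measure_on (ugroup F) m" "compact K"
  shows "emeasure m (unip F ` (+) v ` K) = emeasure m (unip F ` K)"
proof -
  have "unip F ` (+) v ` K = (\<lambda>x. unip F v ** x) ` (unip F ` K)"
    by (auto simp: unip_mult image_image)
  then show ?thesis
    using assms haar_compact(1)[OF assms] unip_in_ugroup by (simp add: haar_measure_on_def)
qed

text \<open>By left invariance all translates of \<open>K\<close> have the same measure, and together they cover each
  point of \<open>W\<close> at most \<open>c\<close> times. This takes the place of a comparison with Lebesgue measure and
  of Fubini's theorem.\<close>

lemma haar_packing: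
  assumes m: "haar_measure_on (ugroup F) m" and K: "compact K" and W: "compact W"
    and sub: "\<And>k. k \<le> n \<Longrightarrow> (+) (v k) ` K \<subseteq> W"
    and mult: "\<And>p. card {k. k \<le> n \<and> p - v k \<in> K} \<le> c"
  shows "real (Suc n) * measure m (unip F ` K) \<le> real c * measure m (unip F ` W)"
proof -
  note hK = haar_compact[OF m K] and hW = haar_compact[OF m W]
  have cK: "compact ((+) (v k) ` K)" for k
    using K by (rule compact_continuous_image[rotated]) (intro continuous_intros)
  note hk = haar_compact[OF m cK]
  have "(\<Sum>k\<le>n. emeasure m (unip F ` (+) (v k) ` K))
      = (\<Sum>k\<le>n. \<integral>\<^sup>+ x. indicator (unip F ` (+) (v k) ` K) x \<partial>m)"
    using hk(1) by (intro sum.cong refl) simp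
  also have "\<dots> = (\<integral>\<^sup>+ x. (\<Sum>k\<le>n. indicator (unip F ` (+) (v k) ` K) x) \<partial>m)"
    using hk(1) by (intro nn_integral_sum[symmetric]) auto
  also have "\<dots> \<le> (\<integral>\<^sup>+ x. of_nat c * indicator (unip F ` W) x \<partial>m)"
  proof (rule nn_integral_mono)
    fix x
    have eq: "(\<Sum>k\<le>n. indicator (unip F ` (+) (v k) ` K) x :: ennreal)
        = of_nat (card {k. k \<le> n \<and> x \<in> unip F ` (+) (v k) ` K})"
      by (simp add: indicator_def sum.If_cases Int_def)
    show "(\<Sum>k\<le>n. indicator (unip F ` (+) (v k) ` K) x :: ennreal)
        \<le> of_nat c * indicator (unip F ` W) x"
    proof (cases "x \<in> unip F ` W")
      case True
      then obtain p where p: "x = unip F p" by auto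
      have "{k. k \<le> n \<and> x \<in> unip F ` (+) (v k) ` K} = {k. k \<le> n \<and> p - v k \<in> K}"
        by (auto simp: p unip_inj image_iff) (metis add_diff_cancel_left' diff_add_cancel
            add.commute)+
      with mult[of p] True show ?thesis unfolding eq by simp
    next
      case False
      then have "{k. k \<le> n \<and> x \<in> unip F ` (+) (v k) ` K} = {}" using sub by auto
      with False show ?thesis unfolding eq by simp
    qed
  qed
  also have "\<dots> = of_nat c * emeasure m (unip F ` W)"
    using hW(1) by (simp add: nn_integral_cmult)
  finally have "of_nat (Suc n) * emeasure m (unip F ` K) \<le> of_nat c * emeasure m (unip F ` W)"
    by (simp add: haar_translate[OF m K])
  moreover have "emeasure m (unip F ` K) = ennreal (measure m (unip F ` K))"
    using hK(2) by (intro emeasure_eq_ennreal_measure) auto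
  moreover have "emeasure m (unip F ` W) = ennreal (measure m (unip F ` W))"
    using hW(2) by (intro emeasure_eq_ennreal_measure) auto
  ultimately show ?thesis
    by (simp add: ennreal_of_nat_eq_real_of_nat ennreal_mult'[symmetric] del: of_nat_Suc)
qed

definition param_box :: "real \<Rightarrow> (real \<times> real) set" where
  "param_box R = {p. \<bar>fst p\<bar> \<le> R \<and> \<bar>snd p\<bar> \<le> R}"

lemma param_box_cbox: "param_box R = cbox (-R, -R) (R, R)"
  by (auto simp: param_box_def cbox_Pair_eq)

lemma compact_param_box: "compact (param_box R)"
  by (simp add: param_box_cbox)

text \<open>Divided differences recover the coefficients of a quadratic polynomial from its values at
  three separated points.\<close>

lemma quadratic_three_points:
  fixes c0 c1 c2 \<eta> \<tau> :: real
  assumes small: "\<And>i. i \<in> {s, t, u} \<Longrightarrow> \<bar>c0 + c1 * i + c2 * i\<^sup>2\<bar> \<le> \<eta>"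
    and rng: "\<And>i. i \<in> {s, t, u} \<Longrightarrow> 0 \<le> i \<and> i \<le> 1"
    and sep: "\<tau> \<le> \<bar>s - t\<bar>" "\<tau> \<le> \<bar>t - u\<bar>" "\<tau> \<le> \<bar>s - u\<bar>"
    and \<tau>: "0 < \<tau>" "\<tau> \<le> 1"
  shows "\<tau>\<^sup>2 * \<bar>c2\<bar> \<le> 4 * \<eta>" "\<tau>\<^sup>2 * \<bar>c1\<bar> \<le> 10 * \<eta>"
proof -
  have \<eta>: "0 \<le> \<eta>" using small[of s] by auto
  have dd: "\<tau> * \<bar>c1 + c2 * (x + y)\<bar> \<le> 2 * \<eta>"
    if "\<tau> \<le> \<bar>x - y\<bar>" "x \<in> {s,t,u}" "y \<in> {s,t,u}" for x y
  proof -
    have "\<tau> * \<bar>c1 + c2 * (x + y)\<bar> \<le> \<bar>x - y\<bar> * \<bar>c1 + c2 * (x + y)\<bar>"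
      by (rule mult_right_mono[OF that(1)]) simp
    also have "\<dots> = \<bar>(c0 + c1 * x + c2 * x\<^sup>2) - (c0 + c1 * y + c2 * y\<^sup>2)\<bar>"
      unfolding abs_mult[symmetric] by (simp add: algebra_simps power2_eq_square)
    also have "\<dots> \<le> 2 * \<eta>" using small[OF that(2)] small[OF that(3)] by linarith
    finally show ?thesis .
  qed
  have st: "\<tau> * \<bar>c1 + c2 * (s + t)\<bar> \<le> 2 * \<eta>" by (rule dd[OF sep(1)]) auto
  have tu: "\<tau> * \<bar>c1 + c2 * (t + u)\<bar> \<le> 2 * \<eta>" by (rule dd[OF sep(2)]) auto
  have "\<tau> * \<bar>c2\<bar> \<le> \<bar>s - u\<bar> * \<bar>c2\<bar>" by (rule mult_right_mono[OF sep(3)]) simp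
  also have "\<dots> = \<bar>(c1 + c2 * (s + t)) - (c1 + c2 * (t + u))\<bar>"
    unfolding abs_mult[symmetric] by (simp add: algebra_simps)
  also have "\<dots> \<le> \<bar>c1 + c2 * (s + t)\<bar> + \<bar>c1 + c2 * (t + u)\<bar>" by linarith
  finally have "\<tau> * (\<tau> * \<bar>c2\<bar>) \<le> \<tau> * (\<bar>c1 + c2 * (s + t)\<bar> + \<bar>c1 + c2 * (t + u)\<bar>)"
    using \<tau> by (intro mult_left_mono) auto
  with st tu show c2: "\<tau>\<^sup>2 * \<bar>c2\<bar> \<le> 4 * \<eta>" by (simp add: algebra_simps power2_eq_square)
  have "\<bar>c1\<bar> \<le> \<bar>c1 + c2 * (s + t)\<bar> + \<bar>c2\<bar> * 2"
  proof -
    have "\<bar>c2 * (s + t)\<bar> \<le> \<bar>c2\<bar> * 2"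
      unfolding abs_mult using rng[of s] rng[of t] by (intro mult_left_mono) auto
    then show ?thesis by linarith
  qed
  then have "\<tau>\<^sup>2 * \<bar>c1\<bar> \<le> \<tau>\<^sup>2 * (\<bar>c1 + c2 * (s + t)\<bar> + \<bar>c2\<bar> * 2)"
    by (intro mult_left_mono) auto
  also have "\<dots> = \<tau> * (\<tau> * \<bar>c1 + c2 * (s + t)\<bar>) + 2 * (\<tau>\<^sup>2 * \<bar>c2\<bar>)"
    by (simp add: algebra_simps power2_eq_square)
  also have "\<dots> \<le> 1 * (2 * \<eta>) + 2 * (4 * \<eta>)"
    using \<tau> st c2 \<eta> by (intro add_mono[OF mult_mono[of \<tau> 1]]) (auto simp: mult.commute)
  finally show "\<tau>\<^sup>2 * \<bar>c1\<bar> \<le> 10 * \<eta>" by simp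
qed

definition quad :: "form \<Rightarrow> real \<Rightarrow> real \<Rightarrow> real \<Rightarrow> real \<times> real \<Rightarrow> real \<times> real \<Rightarrow> real" where
  "quad F \<alpha> \<beta> \<kappa> a p = \<alpha> * fst (p - a) + \<beta> * snd (p - a) + \<kappa> * nform F (p - a)"

definition nform_polar :: "form \<Rightarrow> real \<times> real \<Rightarrow> real \<times> real \<Rightarrow> real" where
  "nform_polar F p q = (case F of Form22 \<Rightarrow> fst p * snd q + snd p * fst q | Form31 \<Rightarrow> fst p * fst q +
      snd p * snd q)"

text \<open>Along a line the polynomial is quadratic, with leading coefficient \<open>\<kappa>\<close> times the value of
  the binary form at the direction.\<close>

lemma quad_line: "quad F \<alpha> \<beta> \<kappa> a (p - t *\<^sub>R e)
  = quad F \<alpha> \<beta> \<kappa> a p + (- (\<alpha> * fst e + \<beta> * snd e + \<kappa> * nform_polar F (p - a) e)) * t + (\<kappa> * nform F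
      e) * t\<^sup>2"
  by (cases F) (auto simp: quad_def nform_def nform_polar_def field_simps power2_eq_square)

text \<open>Translate the sublevel set \<open>K\<close> by the multiples \<open>k \<tau> e\<close> of a direction \<open>e\<close>. A point in three
  of the translates would give three points of \<open>K\<close> on one line, separated by \<open>\<tau>\<close>; by
  \<open>quadratic_three_points\<close> all coefficients of the polynomial would then be small, against the
  hypothesis. So about \<open>1 / \<tau>\<close> translates overlap at most twice.\<close>

lemma quad_sublevel_measure:
  assumes m: "haar_measure_on (ugroup F) m" and a: "a \<in> param_box 1"
    and \<tau>: "0 < \<tau>" "\<tau> \<le> 1"
    and big: "40 * \<eta> < \<tau>\<^sup>2 * \<bar>\<alpha>\<bar> \<or> 40 * \<eta> < \<tau>\<^sup>2 * \<bar>\<beta>\<bar> \<or> 40 * \<eta> < \<tau>\<^sup>2 * \<bar>\<kappa>\<bar>"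
  defines "K \<equiv> {p \<in> param_box 1. \<bar>quad F \<alpha> \<beta> \<kappa> a p\<bar> \<le> \<eta>}"
  shows "unip F ` K \<in> sets m" "measure m (unip F ` K) \<le> 2 * \<tau> * measure m (unip F ` param_box 2)"
proof -
  have K: "compact K"
  proof -
    have "closed {p. \<bar>quad F \<alpha> \<beta> \<kappa> a p\<bar> \<le> \<eta>}"
      unfolding quad_def by (intro closed_Collect_le continuous_intros)
    then have "compact (param_box 1 \<inter> {p. \<bar>quad F \<alpha> \<beta> \<kappa> a p\<bar> \<le> \<eta>})"
      by (rule compact_Int_closed[OF compact_param_box])
    then show ?thesis by (simp add: K_def Int_def)
  qed
  show "unip F ` K \<in> sets m" by (rule haar_compact(1)[OF m K])
  \<comment> \<open>the sign makes \<open>\<alpha>\<close> and \<open>\<beta> * snd e\<close> add up without cancellation\<close>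
  define e :: "real \<times> real" where "e = (if 0 \<le> \<alpha> * \<beta> then (1, 1) else (1, -1))"
  have e1: "fst e = 1" and e2: "\<bar>snd e\<bar> = 1" and ne: "\<bar>nform F e\<bar> = 1"
    by (cases F; simp add: e_def nform_def)+
  have dir: "\<bar>\<alpha>\<bar> \<le> \<bar>\<alpha> * fst e + \<beta> * snd e\<bar>" "\<bar>\<beta>\<bar> \<le> \<bar>\<alpha> * fst e + \<beta> * snd e\<bar>"
    by (auto simp: e_def zero_le_mult_iff)
  define n where "n = nat \<lfloor>1 / \<tau>\<rfloor>"
  have nle: "real n * \<tau> \<le> 1" and nge: "1 / \<tau> \<le> real (Suc n)"
  proof -
    have "real n \<le> 1 / \<tau>" using \<tau> by (simp add: n_def)
    then show "real n * \<tau> \<le> 1" using \<tau> by (simp add: field_simps)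
    show "1 / \<tau> \<le> real (Suc n)" using \<tau> by (simp add: n_def) linarith
  qed
  have rng: "0 \<le> real k * \<tau> \<and> real k * \<tau> \<le> 1" if "k \<le> n" for k
  proof -
    have "real k * \<tau> \<le> real n * \<tau>" using that \<tau> by (intro mult_right_mono) auto
    from order_trans[OF this nle] \<tau> show ?thesis by simp
  qed
  have stay: "(+) ((real k * \<tau>) *\<^sub>R e) ` K \<subseteq> param_box 2" if "k \<le> n" for k
  proof
    fix p assume "p \<in> (+) ((real k * \<tau>) *\<^sub>R e) ` K"
    then obtain q where q: "q \<in> param_box 1" "p = (real k * \<tau>) *\<^sub>R e + q" by (auto simp: K_def)
    have "\<bar>real k * \<tau> * snd e\<bar> \<le> 1" "\<bar>real k * \<tau> * fst e\<bar> \<le> 1"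
      unfolding abs_mult e1 e2 using rng[OF that] by (auto simp: abs_mult)
    with q show "p \<in> param_box 2" by (auto simp: param_box_def)
  qed
  have two: "card {k. k \<le> n \<and> p - (real k * \<tau>) *\<^sub>R e \<in> K} \<le> 2" for p
  proof (rule ccontr)
    define S where "S = {k. k \<le> n \<and> p - (real k * \<tau>) *\<^sub>R e \<in> K}"
    assume "\<not> card {k. k \<le> n \<and> p - (real k * \<tau>) *\<^sub>R e \<in> K} \<le> 2"
    then have "3 \<le> card S" by (simp add: S_def)
    then obtain T where T: "T \<subseteq> S" "card T = 3" by (meson obtain_subset_with_card_n)
    then obtain i j k where ijk: "T = {i, j, k}" "i \<noteq> j" "j \<noteq> k" "i \<noteq> k"
      by (auto simp: card_3_iff)
    have inS: "l \<in> S" if "l \<in> {i,j,k}" for l using that T ijk by auto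
    have sep: "\<tau> \<le> \<bar>real x * \<tau> - real y * \<tau>\<bar>" if "x \<noteq> y" for x y :: nat
    proof -
      have "1 \<le> \<bar>real x - real y\<bar>" using that by linarith
      then have "1 * \<tau> \<le> \<bar>real x - real y\<bar> * \<tau>" using \<tau> by (intro mult_right_mono) auto
      also have "\<dots> = \<bar>real x * \<tau> - real y * \<tau>\<bar>"
        using \<tau> by (simp add: left_diff_distrib[symmetric] abs_mult)
      finally show ?thesis by simp
    qed
    have p: "p \<in> param_box 2"
    proof -
      have i: "i \<le> n" "p - (real i * \<tau>) *\<^sub>R e \<in> K" using inS[of i] by (auto simp: S_def)
      then have "p \<in> (+) ((real i * \<tau>) *\<^sub>R e) ` K"
        by (intro image_eqI[of _ _ "p - (real i * \<tau>) *\<^sub>R e"]) auto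
      with stay[OF i(1)] show ?thesis by blast
    qed
    let ?c1 = "\<alpha> * fst e + \<beta> * snd e + \<kappa> * nform_polar F (p - a) e"
    have small: "\<bar>quad F \<alpha> \<beta> \<kappa> a p + (- ?c1) * x + (\<kappa> * nform F e) * x\<^sup>2\<bar> \<le> \<eta>"
      if "x \<in> {real i * \<tau>, real j * \<tau>, real k * \<tau>}" for x
      using that inS unfolding quad_line[symmetric] by (auto simp: S_def K_def)
    have r: "0 \<le> x \<and> x \<le> 1" if "x \<in> {real i * \<tau>, real j * \<tau>, real k * \<tau>}" for x
      using that inS rng by (auto simp: S_def)
    note q = quadratic_three_points[OF small r sep[OF ijk(2)] sep[OF ijk(3)] sep[OF ijk(4)] \<tau>]
    have kap: "\<tau>\<^sup>2 * \<bar>\<kappa>\<bar> \<le> 4 * \<eta>" using q(1) by (simp add: abs_mult ne)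
    have c1: "\<tau>\<^sup>2 * \<bar>?c1\<bar> \<le> 10 * \<eta>" using q(2) by (simp only: abs_minus_cancel)
    have b: "\<bar>nform_polar F (p - a) e\<bar> \<le> 6"
    proof -
      have pa: "\<bar>fst (p - a)\<bar> \<le> 3" "\<bar>snd (p - a)\<bar> \<le> 3" using p a by (auto simp: param_box_def)
      then have "\<bar>fst (p - a) * snd e\<bar> \<le> 3" "\<bar>snd (p - a) * snd e\<bar> \<le> 3"
        unfolding abs_mult e2 by auto
      with pa have "\<bar>fst (p - a) * snd e + snd (p - a) * 1\<bar>
          \<le> 6" "\<bar>fst (p - a) * 1 + snd (p - a) * snd e\<bar> \<le> 6"
        by (intro order_trans[OF abs_triangle_ineq]; simp)+
      then show ?thesis unfolding nform_polar_def by (cases F) (simp_all only: e1 form.case)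
    qed
    have "\<bar>\<alpha> * fst e + \<beta> * snd e\<bar> \<le> \<bar>?c1\<bar> + 6 * \<bar>\<kappa>\<bar>"
    proof -
      have "\<bar>\<kappa> * nform_polar F (p - a) e\<bar> \<le> \<bar>\<kappa>\<bar> * 6"
        unfolding abs_mult by (intro mult_left_mono b) auto
      then show ?thesis by linarith
    qed
    then have "\<tau>\<^sup>2 * \<bar>\<alpha> * fst e + \<beta> * snd e\<bar> \<le> \<tau>\<^sup>2 * (\<bar>?c1\<bar> + 6 * \<bar>\<kappa>\<bar>)"
      by (intro mult_left_mono) auto
    also have "\<dots> \<le> 34 * \<eta>" using c1 kap by (simp add: algebra_simps)
    finally have ab: "\<tau>\<^sup>2 * \<bar>\<alpha> * fst e + \<beta> * snd e\<bar> \<le> 34 * \<eta>" .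
    have \<eta>: "0 \<le> \<eta>"
    proof -
      have "0 \<le> \<tau>\<^sup>2 * \<bar>\<kappa>\<bar>" by simp
      with kap show ?thesis by linarith
    qed
    have "\<tau>\<^sup>2 * \<bar>\<alpha>\<bar> \<le> 34 * \<eta>" "\<tau>\<^sup>2 * \<bar>\<beta>\<bar> \<le> 34 * \<eta>"
      using mult_left_mono[OF dir(1), of "\<tau>\<^sup>2"] mult_left_mono[OF dir(2), of "\<tau>\<^sup>2"] ab by auto
    with kap big \<eta> show False by linarith
  qed
  have "real (Suc n) * measure m (unip F ` K) \<le> real 2 * measure m (unip F ` param_box 2)"
    by (rule haar_packing[OF m K compact_param_box stay two])
  moreover have "1 / \<tau> * measure m (unip F ` K) \<le> real (Suc n) * measure m (unip F ` K)"
    by (rule mult_right_mono[OF nge]) simp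
  ultimately have "1 / \<tau> * measure m (unip F ` K) \<le> 2 * measure m (unip F ` param_box 2)" by simp
  then show "measure m (unip F ` K) \<le> 2 * \<tau> * measure m (unip F ` param_box 2)"
    using \<tau> by (simp add: field_simps)
qed

section \<open>The jets of a symmetric form on the null cone\<close>

lemma entry_le_infnorm: "\<bar>x $ i $ j\<bar> \<le> infnorm (x :: real^'n^'m)"
  using Basis_le_infnorm[of "axis i (axis j 1)" x]
  by (simp add: inner_axis axis_in_Basis_iff)

lemma infnorm_le_entries:
  assumes "\<And>i j. \<bar>x $ i $ j\<bar> \<le> c"
  shows "infnorm (x :: real^'n^'m) \<le> c"
  unfolding infnorm_Max using assms
  by (subst Max_le_iff) (auto simp: Basis_vec_def inner_axis)

lemma rrep_Ad:
  assumes "x \<in> rrep F" shows "Ad (unip F p) x \<in> rrep F"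
proof -
  have x: "trace x = 0" "jmat F ** transpose x ** jmat F = x" using assms by (auto simp: rrep_iff)
  have "trace (unip F p ** x ** unip F (- p)) = trace (unip F (- p) ** (unip F p ** x))"
    by (rule trace_mul_sym)
  also have "\<dots> = trace x" by (simp add: matrix_mul_assoc unip_mult unip_0)
  finally have 1: "trace (Ad (unip F p) x) = 0" using x by (simp add: Ad_unip)
  have "jmat F ** transpose (Ad (unip F p) x) ** jmat F
      = (jmat F ** transpose (unip F (- p))) ** transpose x ** (transpose (unip F p) ** jmat F)"
    by (simp add: Ad_unip matrix_transpose_mul matrix_mul_assoc)
  also have "\<dots> = unip F p ** (jmat F ** transpose x ** jmat F) ** unip F (- p)"
    by (simp add: unip_jmat jmat_unip matrix_mul_assoc)
  also have "\<dots> = Ad (unip F p) x" using x by (simp add: Ad_unip)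
  finally show ?thesis using 1 by (simp add: rrep_iff)
qed

lemma Ad_Ad: "Ad (unip F p) (Ad (unip F q) x) = Ad (unip F (p + q)) x"
proof -
  have "Ad (unip F p) (Ad (unip F q) x)
      = (unip F p ** unip F q) ** x ** (unip F (- q) ** unip F (- p))"
    by (simp add: Ad_unip matrix_mul_assoc)
  then show ?thesis by (simp add: unip_mult Ad_unip add.commute)
qed

lemma unip_entry_le: "p \<in> param_box 1 \<Longrightarrow> \<bar>unip F p $ i $ j\<bar> \<le> 1"
proof -
  assume p: "p \<in> param_box 1"
  have "\<bar>snd p\<bar> * \<bar>fst p\<bar> \<le> 1 * 1" using p unfolding param_box_def by (intro mult_mono) auto
  moreover have "(fst p)\<^sup>2 \<le> 1" "(snd p)\<^sup>2 \<le> 1"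
    using p by (auto simp: param_box_def abs_square_le_1)
  moreover have "\<forall>i j. \<bar>unip F p $ i $ j\<bar> \<le> 1"
    using p calculation by (cases F) (auto simp: unip_def forall_4 param_box_def abs_mult)
  ultimately show ?thesis by blast
qed

lemma Ad_entry_le:
  assumes "p \<in> param_box 1" and h: "infnorm x \<le> h"
  shows "\<bar>Ad (unip F p) x $ i $ j\<bar> \<le> 16 * h"
proof -
  have mp: "- p \<in> param_box 1" using assms by (simp add: param_box_def)
  have "\<bar>unip F p $ i $ k * x $ k $ l * unip F (- p) $ l $ j\<bar> \<le> 1 * h * 1" for k l
    unfolding abs_mult
    using unip_entry_le[OF assms(1)] unip_entry_le[OF mp] order_trans[OF entry_le_infnorm h]
      order_trans[OF infnorm_pos_le h]
    by (intro mult_mono mult_nonneg_nonneg) auto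
  then have "\<bar>\<Sum>l\<in>UNIV. \<Sum>k\<in>UNIV. unip F p $ i $ k * x $ k $ l * unip F (- p) $ l $ j\<bar>
      \<le> (\<Sum>l\<in>(UNIV::4 set). \<Sum>k\<in>(UNIV::4 set). h)"
    by (intro order_trans[OF sum_abs] sum_mono) auto
  moreover have "Ad (unip F p) x $ i $ j
      = (\<Sum>l\<in>UNIV. \<Sum>k\<in>UNIV. unip F p $ i $ k * x $ k $ l * unip F (- p) $ l $ j)"
    by (simp add: Ad_unip matrix_matrix_mult_def sum_distrib_right)
  ultimately show ?thesis by (simp add: sum_4)
qed

text \<open>The symmetric bilinear form \<open>S\<close> attached to a matrix of the representation.\<close>

definition sform :: "form \<Rightarrow> real^4^4 \<Rightarrow> real^4 \<Rightarrow> real^4 \<Rightarrow> real" where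
  "sform F x v w = v \<bullet> ((x ** jmat F) *v w)"

lemma rrep_symmetric: "x \<in> rrep F \<Longrightarrow> transpose (x ** jmat F) = x ** jmat F"
  by (metis jmat_sq matrix_mul_assoc matrix_mul_rid matrix_transpose_mul rrep_iff transpose_jmat)

lemma sform_commute: "x \<in> rrep F \<Longrightarrow> sform F x v w = sform F x w v"
  unfolding sform_def
  by (metis dot_lmul_matrix inner_commute rrep_symmetric transpose_matrix_vector)

lemma sform_Ad: "sform F (Ad (unip F p) x) v w = sform F x (v v* unip F p) (w v* unip F p)"
proof -
  have "Ad (unip F p) x ** jmat F = unip F p ** (x ** jmat F) ** transpose (unip F p)"
    by (simp add: Ad_unip unip_jmat[symmetric] matrix_mul_assoc[symmetric])
  then show ?thesis
    by (simp add: sform_def matrix_vector_mul_assoc[symmetric] dot_lmul_matrix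
        transpose_matrix_vector)
qed

lemma cone_point_translate: "cone_point F q v* unip F p = cone_point F (q + p)"
  by (cases F) (simp_all add: vec_eq_iff forall_4 vector_matrix_mult_def sum_4 cone_point_def
      unip_def nform_def
    field_simps power2_eq_square)

text \<open>In the differences of these ratios the ambiguity of \<open>S\<close> modulo multiples of the quadratic
  form cancels.\<close>

definition edge :: "form \<Rightarrow> real^4^4 \<Rightarrow> real \<times> real \<Rightarrow> real \<times> real \<Rightarrow> real" where
  "edge F x p q = sform F x (cone_point F p) (cone_point F q) / nform F (q - p)"

lemma nform_minus: "nform F (- p) = nform F p"
  by (cases F) (simp_all add: nform_def)

lemma nform_diff_commute: "nform F (p - q) = nform F (q - p)"
  using nform_minus[of F "p - q"] by simp

lemma edge_commute: "x \<in> rrep F \<Longrightarrow> edge F x p q = edge F x q p"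
  unfolding edge_def by (subst nform_diff_commute, subst sform_commute) auto

lemma edge_Ad: "edge F (Ad (unip F p) x) q q' = edge F x (q + p) (q' + p)"
  by (simp add: edge_def sform_Ad cone_point_translate)

text \<open>A bound for the three coordinates of the projection at \<open>p\<close>. Seen as a quadratic function of
  the parameter, the form has at \<open>p\<close> a 1-jet given by these coordinates.\<close>

definition jet_le :: "form \<Rightarrow> real^4^4 \<Rightarrow> real \<times> real \<Rightarrow> real \<Rightarrow> bool" where
  "jet_le F x p h \<longleftrightarrow> (\<forall>k\<in>{2, 3, 4}. \<bar>Ad (unip F p) x $ 1 $ k\<bar> \<le> h)"

lemma jet_leD:
  assumes "jet_le F x p h"
  shows "\<bar>(Ad (unip F p) x ** jmat F) $ 1 $ 1\<bar> \<le> h"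
    "\<bar>(Ad (unip F p) x ** jmat F) $ 1 $ 2\<bar> \<le> h"
    "\<bar>(Ad (unip F p) x ** jmat F) $ 1 $ 3\<bar> \<le> h"
  using assms by (cases F; simp add: jet_le_def matrix_matrix_mult_def sum_4 jmat_def)+

lemma sform_cone_point_0: "sform F y (cone_point F 0) (cone_point F d)
    = (y ** jmat F) $ 1 $ 1 + (y ** jmat F) $ 1 $ 2 * fst d
    + (y ** jmat F) $ 1 $ 3 * snd d + (y ** jmat F) $ 1 $ 4 * nform F d"
  unfolding sform_def inner_vec_def matrix_vector_mult_def
  by (cases F) (simp_all add: sum_4 cone_point_def nform_def)

lemma edge_cone_point_0: "edge F x p q
    = sform F (Ad (unip F p) x) (cone_point F 0) (cone_point F (q - p)) / nform F (q - p)"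
  using edge_Ad[of F p x 0 "q - p"] by (auto simp: edge_def)

lemma jet_le_diagonal: "jet_le F x p h \<Longrightarrow> \<bar>sform F x (cone_point F p) (cone_point F p)\<bar> \<le> h"
  using jet_leD(1)[of F x p h] sform_cone_point_0[of F "Ad (unip F p) x" 0] sform_Ad[of F p x
    "cone_point F 0" "cone_point F 0"]
  by (cases F) (simp_all add: cone_point_translate nform_def)

lemma affine_part_le:
  fixes a b c :: real
  assumes "\<bar>a\<bar> \<le> h" "\<bar>b\<bar> \<le> h" "\<bar>c\<bar> \<le> h" "\<bar>u\<bar> \<le> R" "\<bar>v\<bar> \<le> R"
  shows "\<bar>a + b * u + c * v\<bar> \<le> (1 + 2 * R) * h"
proof -
  have "\<bar>b * u\<bar> \<le> h * R" "\<bar>c * v\<bar> \<le> h * R"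
    unfolding abs_mult using assms by (auto intro!: mult_mono)
  with assms(1) show ?thesis by (simp add: algebra_simps)
qed

text \<open>Translating \<open>p\<close> to the origin, \<open>S(v\<^sub>p, v\<^sub>q)\<close> becomes a combination of the four entries of
  the first row of a matrix, and the fourth entry comes with the coefficient \<open>N(q - p)\<close>. After
  division it is a constant that does not depend on \<open>q\<close>; the other three entries are coordinates
  of the projection.\<close>

lemma edge_diff_le:
  assumes "jet_le F x p h" "p \<in> param_box 1" "q \<in> param_box 1" "q' \<in> param_box 1"
    and \<nu>: "0 < \<nu>" "\<nu> < \<bar>nform F (q - p)\<bar>" "\<nu> < \<bar>nform F (q' - p)\<bar>"
  shows "\<bar>edge F x p q - edge F x p q'\<bar> \<le> 10 * h / \<nu>"
proof -
  define s where "s = Ad (unip F p) x ** jmat F"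
  note j = jet_leD[OF assms(1), folded s_def]
  define aff where "aff r = s $ 1 $ 1 + s $ 1 $ 2 * fst (r - p) + s $ 1 $ 3 * snd (r - p)" for r
  have edge: "edge F x p r = s $ 1 $ 4 + aff r / nform F (r - p)"
    and b: "\<bar>aff r / nform F (r - p)\<bar> \<le> 5 * h / \<nu>"
    if "r \<in> param_box 1" "\<nu> < \<bar>nform F (r - p)\<bar>" for r
  proof -
    show "edge F x p r = s $ 1 $ 4 + aff r / nform F (r - p)"
      using that \<nu> by (auto simp: edge_cone_point_0 sform_cone_point_0 s_def aff_def field_simps)
    have "\<bar>aff r\<bar> \<le> (1 + 2 * 2) * h" unfolding aff_def
      using that assms(2) by (intro affine_part_le j) (auto simp: param_box_def)
    then have "\<bar>aff r\<bar> \<le> 5 * h" by simp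
    with that \<nu> show "\<bar>aff r / nform F (r - p)\<bar> \<le> 5 * h / \<nu>"
      unfolding abs_divide using \<nu> that by (intro frac_le) auto
  qed
  show ?thesis
    using edge[OF assms(3) \<nu>(2)] edge[OF assms(4) \<nu>(3)] b[OF assms(3) \<nu>(2)] b[OF assms(4) \<nu>(3)]
      by linarith
qed

text \<open>The last three coordinates of \<open>v\<^sub>p\<close>, the first one being \<open>1\<close>.\<close>

definition par_vec :: "form \<Rightarrow> real \<times> real \<Rightarrow> real^3" where
  "par_vec F p = vector [fst p, snd p, nform F p]"

text \<open>The determinant of the four vectors \<open>v\<^sub>a, v\<^sub>p, v\<^sub>q, v\<^sub>r\<close>, computed after translating \<open>a\<close> to
  the origin.\<close>

definition det3 :: "form \<Rightarrow> real \<times> real \<Rightarrow> real \<times> real \<Rightarrow> real \<times> real \<Rightarrow> real \<times> real \<Rightarrow> real" where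
  "det3 F a p q r = par_vec F (p - a) \<bullet> cross3 (par_vec F (q - a)) (par_vec F (r - a))"

lemma cramer_cross3:
  fixes u v w x :: "real^3"
  shows "(u \<bullet> cross3 v w) *\<^sub>R x
    = (x \<bullet> cross3 v w) *\<^sub>R u + (x \<bullet> cross3 w u) *\<^sub>R v + (x \<bullet> cross3 u v) *\<^sub>R w"
  by (simp add: cross3_def inner_vec_def sum_3 vec_eq_iff forall_3 vector_def; algebra)

lemma det3_cyclic: "det3 F a p q r = det3 F a q r p"
  by (simp add: det3_def cross3_def inner_vec_def sum_3; algebra)

lemma bilinear_basis_bound:
  fixes b :: "real^3 \<Rightarrow> real^3 \<Rightarrow> real" and w :: "nat \<Rightarrow> real^3"
  assumes b: "bilinear b"
    and H: "\<And>i j. i < 3 \<Longrightarrow> j < 3 \<Longrightarrow> \<bar>b (w i) (w j)\<bar> \<le> H"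
    and x: "D *\<^sub>R x = (\<Sum>i<3. \<xi> i *\<^sub>R w i)" "\<And>i. i < 3 \<Longrightarrow> \<bar>\<xi> i\<bar> \<le> R"
    and y: "D *\<^sub>R y = (\<Sum>i<3. \<upsilon> i *\<^sub>R w i)" "\<And>i. i < 3 \<Longrightarrow> \<bar>\<upsilon> i\<bar> \<le> R"
  shows "D\<^sup>2 * \<bar>b x y\<bar> \<le> 9 * R\<^sup>2 * H"
proof -
  have R: "0 \<le> R" using x(2)[of 0] by auto
  have "D\<^sup>2 * b x y = b (D *\<^sub>R x) (D *\<^sub>R y)"
    by (simp add: bilinear_lmul[OF b] bilinear_rmul[OF b] power2_eq_square)
  also have "\<dots> = (\<Sum>(i,j)\<in>{..<3} \<times> {..<3}. \<xi> i * \<upsilon> j * b (w i) (w j))"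
    unfolding x y by (simp add: bilinear_sum[OF b] bilinear_lmul[OF b] bilinear_rmul[OF b] mult_ac)
  also have "\<bar>\<dots>\<bar> \<le> (\<Sum>(i,j)\<in>{..<3::nat} \<times> {..<3::nat}. R * R * H)"
  proof (rule order_trans[OF sum_abs], rule sum_mono)
    fix ij :: "nat \<times> nat" assume ij: "ij \<in> {..<3} \<times> {..<3}"
    then show "\<bar>case ij of (i, j) \<Rightarrow> \<xi> i * \<upsilon> j * b (w i) (w j)\<bar> \<le> (case ij of (i, j) \<Rightarrow> R * R * H)"
      using R by (auto simp: abs_mult intro!: mult_mono H x y)
  qed
  also have "\<dots> = 9 * R\<^sup>2 * H" by (simp add: power2_eq_square)
  finally show ?thesis by (simp add: abs_mult)
qed

section \<open>Five generic points separate the representation\<close>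

lemma rrep_symmetric_entry: "y \<in> rrep F \<Longrightarrow> (y ** jmat F) $ i $ j = (y ** jmat F) $ j $ i"
  using arg_cong[OF rrep_symmetric, of y F "\<lambda>m. m $ j $ i"]
    by (simp only: transpose_def vec_lambda_beta)

text \<open>The lower right block of \<open>s\<close> after the multiple of the quadratic form that kills the corner
  entry has been removed.\<close>

definition lower_block :: "form \<Rightarrow> real^4^4 \<Rightarrow> real^3^3" where
  "lower_block F s = (let t = s $ 1 $ 4; m = s + t *\<^sub>R jmat F in
     vector [vector [m $ 2 $ 2, m $ 2 $ 3, m $ 2 $ 4], vector [m $ 3 $ 2, m $ 3 $ 3, m $ 3 $ 4],
             vector [m $ 4 $ 2, m $ 4 $ 3, m $ 4 $ 4]])"

definition lower_form :: "form \<Rightarrow> real^4^4 \<Rightarrow> real^3 \<Rightarrow> real^3 \<Rightarrow> real" where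
  "lower_form F y u v = u \<bullet> (lower_block F (y ** jmat F) *v v)"

lemma bilinear_lower_form: "bilinear (lower_form F y)"
  unfolding lower_form_def bilinear_def
  by (auto intro!: linearI simp: inner_add_left inner_add_right matrix_vector_right_distrib
      matrix_vector_mult_scaleR)

lemma nform_diff: "nform F (q - p) = nform F p + nform F q - nform_polar F p q"
  by (cases F) (auto simp: nform_def nform_polar_def field_simps power2_eq_square)

lemma sform_expand:
  assumes "y \<in> rrep F"
  defines "s \<equiv> y ** jmat F"
  shows "sform F y (cone_point F p) (cone_point F q)
      = (s $ 1 $ 1 + s $ 1 $ 2 * (fst p + fst q) + s $ 1 $ 3 * (snd p + snd q))
    + s $ 1 $ 4 * nform F (q - p) + lower_form F y (par_vec F p) (par_vec F q)"
proof -
  have sym: "s $ i $ j = s $ j $ i" for i j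
    unfolding s_def by (rule rrep_symmetric_entry[OF assms(1)])
  have s: "s $ 2 $ 1 = s $ 1 $ 2" "s $ 3 $ 1 = s $ 1 $ 3" "s $ 4 $ 1 = s $ 1 $ 4"
    by (rule sym)+
  show ?thesis
    unfolding sform_def lower_form_def s_def[symmetric] nform_diff inner_vec_def
        matrix_vector_mult_def sum_3 sum_4
    by (cases F) (simp_all add: lower_block_def Let_def jmat_def cone_point_def par_vec_def
        nform_polar_def s, simp_all add: algebra_simps)
qed

lemma lower_form_axis: "lower_form F y (axis k 1) (axis l 1) = lower_block F (y ** jmat F) $ k $ l"
  by (simp add: lower_form_def inner_axis' matrix_vector_mul_component matrix_vector_mult_basis
      column_def)

text \<open>The trace condition recovers the multiple of the quadratic form that \<open>lower_block\<close> removes.\<close>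

lemma rrep_trace_entry:
  assumes "y \<in> rrep F"
  defines "s \<equiv> y ** jmat F"
  shows "s $ 1 $ 4 = (case F of
      Form22 \<Rightarrow> (lower_form F y (axis 1 1) (axis 2 1) + lower_form F y (axis 2 1) (axis 1 1)) / 4
    | Form31 \<Rightarrow> (lower_form F y (axis 1 1) (axis 1 1) + lower_form F y (axis 2 1) (axis 2 1)) / 4)"
proof -
  have sym: "s $ i $ j = s $ j $ i" for i j
    unfolding s_def by (rule rrep_symmetric_entry[OF assms(1)])
  have y: "y = s ** jmat F" unfolding s_def by (metis jmat_sq matrix_mul_assoc matrix_mul_rid)
  have "trace (s ** jmat F) = 0" using assms(1) y by (simp add: rrep_iff)
  then show ?thesis
    unfolding lower_form_axis s_def[symmetric] using sym[of 4 1]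
    by (cases F) (simp_all add: trace_def lower_block_def Let_def jmat_def matrix_matrix_mult_def
        sum_4)
qed

lemma entries_from_lower_form:
  assumes y: "y \<in> rrep F"
    and first: "\<bar>(y ** jmat F) $ 1 $ 1\<bar> \<le> E" "\<bar>(y ** jmat F) $ 1 $ 2\<bar> \<le> E" "\<bar>(y ** jmat F) $ 1 $ 3\<bar>
        \<le> E"
    and lower_block: "\<And>k l. \<bar>lower_form F y (axis k 1) (axis l 1)\<bar> \<le> E"
  shows "infnorm y \<le> 2 * E"
proof -
  define s where "s = y ** jmat F"
  have sym: "s $ i $ j = s $ j $ i" for i j
    unfolding s_def by (rule rrep_symmetric_entry[OF y])
  have yx: "y = s ** jmat F" unfolding s_def by (metis jmat_sq matrix_mul_assoc matrix_mul_rid)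
  have E: "0 \<le> E" using first(1) by linarith
  have t: "\<bar>s $ 1 $ 4\<bar> \<le> E"
    using rrep_trace_entry[OF y, folded s_def] lower_block[of 1 2] lower_block[of 2 1]
        lower_block[of 1 1] lower_block[of 2 2]
    by (cases F) simp_all
  have b: "\<bar>lower_block F s $ k $ l\<bar> \<le> E" for k l
    using lower_block[of k l] by (simp add: lower_form_axis s_def)
  define m where "m = s + s $ 1 $ 4 *\<^sub>R jmat F"
  have rows: "lower_block F s $ 1 $ 1 = m $ 2 $ 2" "lower_block F s $ 1 $ 2
      = m $ 2 $ 3" "lower_block F s $ 1 $ 3 = m $ 2 $ 4"
    "lower_block F s $ 2 $ 1 = m $ 3 $ 2" "lower_block F s $ 2 $ 2
        = m $ 3 $ 3" "lower_block F s $ 2 $ 3 = m $ 3 $ 4"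
    "lower_block F s $ 3 $ 1 = m $ 4 $ 2" "lower_block F s $ 3 $ 2
        = m $ 4 $ 3" "lower_block F s $ 3 $ 3 = m $ 4 $ 4"
    by (simp_all only: lower_block_def Let_def m_def vector_3)
  have border: "m $ 1 $ 1 = s $ 1 $ 1" "m $ 1 $ 2 = s $ 1 $ 2" "m $ 1 $ 3 = s $ 1 $ 3" "m $ 1 $ 4
      = 0"
    "m $ 2 $ 1 = s $ 1 $ 2" "m $ 3 $ 1 = s $ 1 $ 3" "m $ 4 $ 1 = 0"
    using sym[of 2 1] sym[of 3 1] sym[of 4 1] by (cases F; simp add: m_def jmat_def)+
  have "\<forall>i j. \<bar>m $ i $ j\<bar> \<le> E"
    unfolding forall_4 border rows[symmetric] using b first[folded s_def] E by simp
  moreover have "\<forall>i j. \<bar>jmat F $ i $ j\<bar> \<le> 1"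
    unfolding forall_4 by (cases F) (simp_all add: jmat_def)
  ultimately have s_le: "\<bar>s $ i $ j\<bar> \<le> 2 * E" for i j
  proof -
    have "\<bar>s $ 1 $ 4 * jmat F $ i $ j\<bar> \<le> E * 1"
      unfolding abs_mult using t \<open>\<forall>i j. \<bar>jmat F $ i $ j\<bar> \<le> 1\<close> E by (intro mult_mono) auto
    moreover have "s $ i $ j = m $ i $ j - s $ 1 $ 4 * jmat F $ i $ j" by (simp add: m_def)
    moreover have "\<bar>m $ i $ j\<bar> \<le> E" using \<open>\<forall>i j. \<bar>m $ i $ j\<bar> \<le> E\<close> by blast
    ultimately show ?thesis by linarith
  qed
  have "\<forall>i j. \<bar>y $ i $ j\<bar> \<le> 2 * E"
    unfolding yx matrix_matrix_mult_def forall_4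
    by (cases F) (simp_all add: sum_4 jmat_def s_le)
  then show ?thesis by (intro infnorm_le_entries) blast
qed

lemma nform_le:
  assumes "p \<in> param_box 1" "q \<in> param_box 1" shows "\<bar>nform F (p - q)\<bar> \<le> 4"
proof -
  have b: "\<bar>fst (p - q)\<bar> \<le> 2" "\<bar>snd (p - q)\<bar> \<le> 2" using assms by (auto simp: param_box_def)
  have "\<bar>fst (p - q)\<bar> * \<bar>snd (p - q)\<bar> \<le> 2 * 2" using b by (intro mult_mono) auto
  moreover have "(fst (p - q))\<^sup>2 \<le> 2\<^sup>2" "(snd (p - q))\<^sup>2 \<le> 2\<^sup>2"
    using b power2_le_iff_abs_le[of 2] by auto
  ultimately show ?thesis by (cases F) (auto simp: nform_def abs_mult)
qed

lemma par_vec_le: "p \<in> param_box 1 \<Longrightarrow> q \<in> param_box 1 \<Longrightarrow> \<bar>par_vec F (p - q) $ i\<bar> \<le> 4"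
  using nform_le[of p q F] exhaust_3[of i] by (auto simp: par_vec_def param_box_def)

lemma cross3_inner_le:
  assumes "\<And>i. \<bar>x $ i\<bar> \<le> c" "\<And>i. \<bar>u $ i\<bar> \<le> 4" "\<And>i. \<bar>v $ i\<bar> \<le> (4::real)"
  shows "\<bar>x \<bullet> cross3 u v\<bar> \<le> 96 * c"
proof -
  have m: "\<bar>u $ i * v $ j\<bar> \<le> 16" for i j
    using mult_mono[OF assms(2)[of i] assms(3)[of j]] by (simp add: abs_mult)
  have "\<bar>cross3 u v $ k\<bar> \<le> 32" for k
    using exhaust_3[of k] m[of 2 3] m[of 3 2] m[of 3 1] m[of 1 3] m[of 1 2] m[of 2 1]
    by (auto simp: cross3_def)
  then have "\<bar>x $ k * cross3 u v $ k\<bar> \<le> c * 32" for k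
    unfolding abs_mult using assms(1)[of k] by (intro mult_mono) auto
  from this[of 1] this[of 2] this[of 3] show ?thesis
    by (simp add: inner_vec_def sum_3)
qed

text \<open>The projections at \<open>p1, p2, p3\<close>, together with the difference \<open>e(p4, p5) - e(p4, p1)\<close>,
  determine \<open>x\<close> with a loss polynomial in \<open>1 / \<tau>\<close>. Translate \<open>p1\<close> to the origin and remove the
  multiple of the quadratic form that makes the upper right entry zero; then the first row is
  small. What remains is a form \<open>b\<close> on a three-dimensional space, with basis \<open>w p2, w p3, w p4\<close>.
  At \<open>w p2\<close> and \<open>w p3\<close> the diagonal values of \<open>b\<close> are bounded by the top coordinates of the
  projections; its other values on this basis, except \<open>b(w p4, w p4)\<close>, are bounded by the
  differences of edge ratios seen at \<open>p2\<close> and \<open>p3\<close>, compared with the edges to \<open>p1\<close>. The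
  remaining one follows by expanding \<open>w p5\<close> in \<open>b(w p4, w p5)\<close>, which the hypothesis on
  \<open>e(p4, p5)\<close> bounds, because the coefficient of \<open>w p4\<close> there is the quotient of the two
  determinants.\<close>

lemma separation:
  assumes x: "x \<in> rrep F" and \<tau>: "0 < \<tau>" "\<tau> \<le> 1"
    and P: "p1 \<in> param_box 1" "p2 \<in> param_box 1" "p3 \<in> param_box 1" "p4 \<in> param_box 1"
      "p5 \<in> param_box 1"
    and N: "\<tau>^3 < \<bar>nform F (p2 - p1)\<bar>" "\<tau>^3 < \<bar>nform F (p3 - p1)\<bar>" "\<tau>^3 < \<bar>nform F (p4 - p1)\<bar>"
      "\<tau>^3 < \<bar>nform F (p5 - p1)\<bar>"
      "\<tau>^3 < \<bar>nform F (p3 - p2)\<bar>" "\<tau>^3 < \<bar>nform F (p4 - p2)\<bar>" "\<tau>^3 < \<bar>nform F (p4 - p3)\<bar>"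
        "\<tau>^3 < \<bar>nform F (p5 - p4)\<bar>"
    and D: "\<tau>^8 < \<bar>det3 F p1 p2 p3 p4\<bar>" "\<tau>^8 < \<bar>det3 F p1 p2 p3 p5\<bar>"
    and J: "jet_le F x p1 h" "jet_le F x p2 h" "jet_le F x p3 h"
    and Z: "\<bar>edge F x p4 p5 - edge F x p4 p1\<bar> \<le> 20 * h / \<tau>^3"
  shows "infnorm x \<le> 10^12 * h / \<tau>^27"
proof -
  define y where "y = Ad (unip F p1) x"
  have y: "y \<in> rrep F" using rrep_Ad[OF x] by (simp add: y_def)
  define s where "s = y ** jmat F"
  define t where "t = s $ 1 $ 4"
  note s1 = jet_leD[OF J(1), folded y_def, folded s_def]
  have h: "0 \<le> h" using s1(1) by linarith
  define \<nu> where "\<nu> = \<tau>^3"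
  have \<nu>: "0 < \<nu>" "\<nu> \<le> 1" using \<tau> by (auto simp: \<nu>_def power_le_one)
  have hle: "h \<le> h / \<nu>" using \<nu> h by (simp add: field_simps mult_left_le_one_le mult_left_le)
  define w where "w p = par_vec F (p - p1)" for p
  define b where "b = lower_form F y"
  define aff where "aff p q = s $ 1 $ 1 + s $ 1 $ 2 * (fst (p - p1) + fst (q - p1))
      + s $ 1 $ 3 * (snd (p - p1) + snd (q - p1))" for p q
  have expand: "sform F x (cone_point F p) (cone_point F q)
      = aff p q + t * nform F (q - p) + b (w p) (w q)" for p q
  proof -
    have "sform F x (cone_point F p) (cone_point F q)
        = sform F y (cone_point F (p - p1)) (cone_point F (q - p1))"
      by (simp add: y_def sform_Ad cone_point_translate)
    then show ?thesis
      unfolding sform_expand[OF y, folded s_def] by (simp add: aff_def t_def b_def w_def)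
  qed
  have aff_le: "\<bar>aff p q\<bar> \<le> 9 * h" if "p \<in> param_box 1" "q \<in> param_box 1" for p q
  proof -
    have "\<bar>aff p q\<bar> \<le> (1 + 2 * 4) * h" unfolding aff_def
      using that P(1) by (intro affine_part_le s1) (auto simp: param_box_def)
    then show ?thesis by simp
  qed
  \<comment> \<open>bounds all values of \<open>b\<close> that the edge ratios control; \<open>109 = 4 * 25 + 9\<close> comes from \<open>off\<close>\<close>
  define H where "H = 109 * h / \<nu>"
  have H: "0 \<le> H" using h \<nu> by (simp add: H_def)
  have diag: "\<bar>b (w p) (w p)\<bar> \<le> H" if "jet_le F x p h" "p \<in> param_box 1" for p
  proof -
    have "nform F 0 = 0" by (cases F) (simp_all add: nform_def)
    then have "b (w p) (w p) = sform F x (cone_point F p) (cone_point F p) - aff p p"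
      using expand[of p p] by simp
    then show ?thesis
      using jet_le_diagonal[OF that(1)] aff_le[OF that(2) that(2)] hle h by (simp add: H_def)
  qed
  have base: "\<bar>edge F x p p1 - t\<bar> \<le> 5 * h / \<nu>" if "p \<in> param_box 1" "\<nu> < \<bar>nform F (p - p1)\<bar>" for p
  proof -
    define a where "a = s $ 1 $ 1 + s $ 1 $ 2 * fst (p - p1) + s $ 1 $ 3 * snd (p - p1)"
    have "edge F x p p1 = edge F x p1 p" by (rule edge_commute[OF x])
    also have "\<dots> = t + a / nform F (p - p1)"
      using that \<nu> by (auto simp: edge_cone_point_0 sform_cone_point_0 y_def[symmetric]
          s_def[symmetric] t_def a_def field_simps)
    finally have "edge F x p p1 - t = a / nform F (p - p1)" by simp
    moreover have "\<bar>a\<bar> \<le> (1 + 2 * 2) * h" unfolding a_def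
      using that P(1) by (intro affine_part_le s1) (auto simp: param_box_def)
    ultimately show ?thesis using \<nu> that h by (auto simp: abs_divide intro!: frac_le)
  qed
  have off: "\<bar>b (w p) (w q)\<bar> \<le> H"
    if "p \<in> param_box 1" "q \<in> param_box 1" "\<nu> < \<bar>nform F (p - p1)\<bar>" "\<nu> < \<bar>nform F (q - p)\<bar>"
      "\<bar>edge F x p q - edge F x p p1\<bar> \<le> 20 * h / \<nu>" for p q
  proof -
    have "b (w p) (w q) = (edge F x p q - t) * nform F (q - p) - aff p q"
      using that \<nu> expand[of p q] by (auto simp: edge_def field_simps)
    moreover have "\<bar>edge F x p q - t\<bar> \<le> 25 * h / \<nu>"
      using that(5) base[OF that(1,3)] by (simp add: abs_le_iff)
    then have "\<bar>(edge F x p q - t) * nform F (q - p)\<bar> \<le> 25 * h / \<nu> * 4"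
      unfolding abs_mult using nform_le[OF that(2,1)] h \<nu> by (intro mult_mono) auto
    ultimately show ?thesis using aff_le[OF that(1,2)] hle by (simp add: H_def)
  qed
  have jet_off: "\<bar>b (w p) (w q)\<bar> \<le> H"
    if "jet_le F x p h" "p \<in> param_box 1" "q \<in> param_box 1" "\<nu> < \<bar>nform F (p - p1)\<bar>"
      "\<nu> < \<bar>nform F (q - p)\<bar>" for p q
  proof -
    have "\<bar>edge F x p q - edge F x p p1\<bar> \<le> 10 * h / \<nu>"
      by (rule edge_diff_le[OF that(1,2,3) P(1) \<nu>(1) that(5)]) (use that(4) nform_diff_commute in
          metis)
    also have "\<dots> \<le> 20 * h / \<nu>" using h \<nu> by (intro divide_right_mono) auto
    finally show ?thesis by (rule off[OF that(2-5)])
  qed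
  have bc: "b u v = b v u" for u v
  proof -
    have sym: "s $ i $ j = s $ j $ i" for i j
      unfolding s_def by (rule rrep_symmetric_entry[OF y])
    have "transpose (lower_block F s) = lower_block F s"
      using sym[of 2 3] sym[of 2 4] sym[of 3 4]
      by (cases F) (simp_all add: vec_eq_iff forall_3 lower_block_def Let_def jmat_def
          transpose_def)
    then show ?thesis unfolding b_def lower_form_def s_def[symmetric]
      by (metis dot_lmul_matrix inner_commute transpose_matrix_vector)
  qed
  note N' = N[folded \<nu>_def]
  have b22: "\<bar>b (w p2) (w p2)\<bar> \<le> H" and b33: "\<bar>b (w p3) (w p3)\<bar> \<le> H"
    using diag J P by auto
  have b23: "\<bar>b (w p2) (w p3)\<bar> \<le> H" by (rule jet_off[OF J(2) P(2,3) N'(1,5)])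
  have b24: "\<bar>b (w p2) (w p4)\<bar> \<le> H" by (rule jet_off[OF J(2) P(2,4) N'(1,6)])
  have b34: "\<bar>b (w p3) (w p4)\<bar> \<le> H" by (rule jet_off[OF J(3) P(3,4) N'(2,7)])
  have b45: "\<bar>b (w p4) (w p5)\<bar> \<le> H" by (rule off[OF P(4,5) N'(3,8) Z[folded \<nu>_def]])
  have wle: "\<bar>w p $ i\<bar> \<le> 4" if "p \<in> param_box 1" for p i
    unfolding w_def by (rule par_vec_le[OF that P(1)])
  define d where "d = \<tau>^8"
  have d: "0 < d" using \<tau> by (simp add: d_def)
  define \<Delta> where "\<Delta> = det3 F p1 p2 p3 p4"
  have \<Delta>: "d < \<bar>\<Delta>\<bar>" "\<bar>\<Delta>\<bar> \<le> 384"
    using D cross3_inner_le[of "w p2" 4 "w p3" "w p4"] wle P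
      by (auto simp: \<Delta>_def d_def det3_def w_def)
  define \<xi> where "\<xi> v = (\<lambda>i::nat. if i = 0 then v \<bullet> cross3 (w p3) (w p4)
     else if i = 1 then v \<bullet> cross3 (w p4) (w p2) else v \<bullet> cross3 (w p2) (w p3))" for v
  define ww where "ww = (\<lambda>i::nat. if i = 0 then w p2 else if i = 1 then w p3 else w p4)"
  have cram: "\<Delta> *\<^sub>R v = (\<Sum>i<3. \<xi> v i *\<^sub>R ww i)" for v
    using cramer_cross3[of "w p2" "w p3" "w p4" v]
    by (simp add: \<Delta>_def det3_def w_def[symmetric] \<xi>_def ww_def numeral_3_eq_3)
  have \<xi>: "\<bar>\<xi> v i\<bar> \<le> 96 * c" if "\<And>i. \<bar>v $ i\<bar> \<le> c" for v c i
    unfolding \<xi>_def using cross3_inner_le[OF that] wle P by auto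
  have b44: "\<bar>b (w p4) (w p4)\<bar> \<le> 1152 * H / d"
  proof -
    have "\<Delta> * b (w p4) (w p5) = b (w p4) (\<Delta> *\<^sub>R w p5)"
      by (simp add: b_def bilinear_rmul[OF bilinear_lower_form])
    also have "\<dots> = \<xi> (w p5) 0 * b (w p4) (w p2) + \<xi> (w p5) 1 * b (w p4) (w p3) + \<xi> (w p5) 2 * b (w
        p4) (w p4)"
      unfolding cram b_def by (simp add: eval_nat_numeral ww_def bilinear_rmul[OF
          bilinear_lower_form]
        bilinear_radd[OF bilinear_lower_form])
    finally have eq: "\<xi> (w p5) 2 * b (w p4) (w p4) = \<Delta> * b (w p4) (w p5)
       - \<xi> (w p5) 0 * b (w p4) (w p2) - \<xi> (w p5) 1 * b (w p4) (w p3)" by simp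
    have "\<bar>\<xi> (w p5) i * b (w p4) (w q)\<bar> \<le> 384 * H" if "\<bar>b (w p4) (w q)\<bar> \<le> H" for i q
      unfolding abs_mult using \<xi>[of "w p5" 4 i] wle[OF P(5)] that by (intro mult_mono) auto
    from this[of p2 0] this[of p3 1]
    have 1: "\<bar>\<xi> (w p5) 0 * b (w p4) (w p2)\<bar> \<le> 384 * H" "\<bar>\<xi> (w p5) 1 * b (w p4) (w p3)\<bar> \<le> 384 * H"
      using b24 b34 bc[of "w p4" "w p2"] bc[of "w p4" "w p3"] by auto
    have 2: "\<bar>\<Delta> * b (w p4) (w p5)\<bar> \<le> 384 * H"
      unfolding abs_mult using \<Delta> b45 by (intro mult_mono) auto
    have le: "\<bar>\<xi> (w p5) 2\<bar> * \<bar>b (w p4) (w p4)\<bar> \<le> 1152 * H"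
      unfolding abs_mult[symmetric] eq using 1 2 by linarith
    have "\<xi> (w p5) 2 = det3 F p1 p2 p3 p5"
      using det3_cyclic[of F p1 p5 p2 p3] by (simp add: \<xi>_def det3_def w_def)
    then have "d * \<bar>b (w p4) (w p4)\<bar> \<le> \<bar>\<xi> (w p5) 2\<bar> * \<bar>b (w p4) (w p4)\<bar>"
      using D(2) by (intro mult_right_mono) (auto simp: d_def)
    with le d show ?thesis by (simp add: field_simps)
  qed
  define H4 where "H4 = 1152 * H / d"
  have HH4: "H \<le> H4"
  proof -
    have "d \<le> 1152" using \<Delta> by linarith
    then have "H * d \<le> H * 1152" using H by (intro mult_left_mono) auto
    then show ?thesis using d by (simp add: H4_def field_simps)
  qed
  have ball: "\<bar>b (ww i) (ww j)\<bar> \<le> H4" for i j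
    using b22 b33 b23 b24 b34 b44[folded H4_def] HH4 bc[of "w p3" "w p2"] bc[of "w p4" "w p2"] bc[of
      "w p4" "w p3"]
    by (auto simp: ww_def)
  define E where "E = 82944 * H4 / d\<^sup>2"
  have H4: "0 \<le> H4" using H HH4 by linarith
  have ent: "\<bar>b (axis k 1) (axis l 1)\<bar> \<le> E" for k l
  proof -
    have ax: "\<bar>(axis k 1 :: real^3) $ i\<bar> \<le> 1" for k i by (simp add: axis_def)
    have "\<Delta>\<^sup>2 * \<bar>b (axis k 1) (axis l 1)\<bar> \<le> 9 * (96 * 1)\<^sup>2 * H4"
      unfolding b_def
      by (rule bilinear_basis_bound[OF bilinear_lower_form ball[unfolded b_def] cram \<xi>[OF ax] cram
          \<xi>[OF ax]])
    moreover have "d\<^sup>2 * \<bar>b (axis k 1) (axis l 1)\<bar> \<le> \<Delta>\<^sup>2 * \<bar>b (axis k 1) (axis l 1)\<bar>"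
      using \<Delta>(1) d by (intro mult_right_mono) (auto simp: abs_le_square_iff[symmetric])
    ultimately have "d\<^sup>2 * \<bar>b (axis k 1) (axis l 1)\<bar> \<le> 82944 * H4" by simp
    with d show ?thesis by (simp add: E_def field_simps)
  qed
  have E: "E = 10415112192 * h / \<tau>^27"
    using \<tau> by (simp add: E_def H4_def H_def d_def \<nu>_def field_simps flip: power_add power_mult)
  have hE: "h \<le> E"
  proof -
    have "\<tau>^27 \<le> 1" using \<tau> by (simp add: power_le_one)
    then have "h * \<tau>^27 \<le> h * 10415112192" using h by (intro mult_left_mono) auto
    then show ?thesis unfolding E using \<tau> by (simp add: field_simps)
  qed
  have y_le: "infnorm y \<le> 2 * E"
    using s1 hE ent by (intro entries_from_lower_form[OF y]) (auto simp: s_def b_def)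
  have x_y: "x = Ad (unip F (- p1)) y"
    unfolding y_def Ad_Ad by (simp only: Ad_unip, simp add: unip_0)
  have "- p1 \<in> param_box 1" using P(1) by (simp add: param_box_def)
  from Ad_entry_le[OF this y_le] have "infnorm x \<le> 16 * (2 * E)"
    unfolding x_y by (rule infnorm_le_entries)
  also have "\<dots> \<le> 10^12 * h / \<tau>^27"
    unfolding E using h \<tau> by (simp add: field_simps mult_left_mono)
  finally show ?thesis .
qed

section \<open>The projections in coordinates\<close>

text \<open>The positions of the matrix entries of positive weight under the adjoint action of \<open>amat\<close>.\<close>

definition upper_weight :: "4 \<Rightarrow> 4 \<Rightarrow> bool" where
  "upper_weight i j \<longleftrightarrow> (i = 1 \<and> j \<noteq> 1) \<or> (j = 4 \<and> i \<noteq> 4)"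

definition upper_part :: "real^4^4 \<Rightarrow> real^4^4" where
  "upper_part y = (\<chi> i j. if upper_weight i j then y $ i $ j else 0)"

lemma orth_proj_unique:
  assumes S: "subspace S" and y: "y \<in> S" "\<And>z. z \<in> S \<Longrightarrow> orthogonal (x - y) z"
  shows "orth_proj S x = y"
  unfolding orth_proj_def
proof (rule the_equality)
  fix y' assume y': "y' \<in> S \<and> (\<forall>z\<in>S. orthogonal (x - y') z)"
  have d: "y - y' \<in> S" using S y y' by (simp add: subspace_diff)
  have "orthogonal (x - y') (y - y')" "orthogonal (x - y) (y - y')" using y' y(2)[OF d] d by auto
  then have "(y - y') \<bullet> (y - y') = 0" by (simp add: orthogonal_def algebra_simps)
  then show "y' = y" by simp
qed (use y in auto)

lemma amat_bracket_entry:
  "(amat ** z - z ** amat) $ i $ j = ((if i = 1 then 1 else if i = 4 then -1 else 0)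
     - (if j = 1 then 1 else if j = 4 then -1 else 0)) * z $ i $ j"
  using exhaust_4[of i] exhaust_4[of j]
  by (auto simp: amat_def matrix_matrix_mult_def sum_4)

lemma ad_eigenspace_upper_weight:
  assumes "z \<in> ad_eigenspace F \<mu>" "1 \<le> \<mu>" "\<not> upper_weight i j"
  shows "z $ i $ j = 0"
proof -
  have "(amat ** z - z ** amat) $ i $ j = \<mu> * z $ i $ j"
    using assms(1) by (simp add: ad_eigenspace_def)
  with assms(2,3) show ?thesis
    unfolding amat_bracket_entry by (auto simp: upper_weight_def split: if_splits)
qed

text \<open>The entries of weight two and those of weight one are separately elements of the
  representation, since the symmetry condition pairs entries of equal weight.\<close>

lemma upper_part_in_rrep_ge:
  assumes y: "y \<in> rrep F" shows "upper_part y \<in> rrep_ge F 1"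
proof -
  define y2 where "y2 = (\<chi> i j. if i = 1 \<and> j = 4 then y $ i $ j else (0 :: real))"
  define y1 where "y1 = upper_part y - y2"
  have sym: "jmat F ** transpose y ** jmat F = y" using y by (simp add: rrep_iff)
  have e: "(jmat F ** transpose y ** jmat F) $ 1 $ 2
      = y $ 1 $ 2" "(jmat F ** transpose y ** jmat F) $ 1 $ 3 = y $ 1 $ 3"
    unfolding sym by simp_all
  have e': "y $ 2 $ 4 = (case F of Form22 \<Rightarrow> - y $ 1 $ 3 | Form31 \<Rightarrow> - y $ 1 $ 2)"
    "y $ 3 $ 4 = (case F of Form22 \<Rightarrow> - y $ 1 $ 2 | Form31 \<Rightarrow> - y $ 1 $ 3)"
    using e by (cases F; simp add: jmat_def matrix_matrix_mult_def transpose_def sum_4)+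
  have "y2 \<in> ad_eigenspace F 2"
    by (cases F) (simp_all add: y2_def ad_eigenspace_def rrep_iff mat4 jmat_def trace_def amat_def)
  moreover have "y1 \<in> ad_eigenspace F 1"
    using e' by (cases F) (simp_all add: y1_def y2_def upper_part_def upper_weight_def
        ad_eigenspace_def rrep_iff mat4 jmat_def trace_def amat_def)
  ultimately have "y1 \<in> rrep_ge F 1" "y2 \<in> rrep_ge F 1"
    unfolding rrep_ge_def by (force intro!: span_base)+
  then have "y1 + y2 \<in> rrep_ge F 1" unfolding rrep_ge_def by (rule span_add)
  then show ?thesis by (simp add: y1_def)
qed

text \<open>Eigenvectors for different eigenvalues are supported on disjoint sets of entries, so the
  orthogonal projection just deletes the entries of weight at most zero.\<close>

lemma orth_proj_rrep_ge:
  assumes y: "y \<in> rrep F" shows "orth_proj (rrep_ge F 1) y = upper_part y"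
proof (rule orth_proj_unique[OF _ upper_part_in_rrep_ge[OF y]])
  show "subspace (rrep_ge F 1)" by (simp add: rrep_ge_def)
  fix z assume "z \<in> rrep_ge F 1"
  then have z: "\<forall>i j. \<not> upper_weight i j \<longrightarrow> z $ i $ j = 0"
    unfolding rrep_ge_def
  proof (rule span_induct_alt)
    fix c :: real and x y :: "real^4^4" assume "x \<in> (\<Union>\<mu>\<in>{1..}. ad_eigenspace F \<mu>)"
      "\<forall>i j. \<not> upper_weight i j \<longrightarrow> y $ i $ j = 0"
    then show "\<forall>i j. \<not> upper_weight i j \<longrightarrow> (c *\<^sub>R x + y) $ i $ j = 0"
      using ad_eigenspace_upper_weight by auto
  qed simp
  show "orthogonal (y - upper_part y) z"
    unfolding orthogonal_def inner_vec_def
    by (intro sum.neutral ballI) (use z in \<open>auto simp: upper_part_def intro!: sum.neutral\<close>)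
qed

lemma proj_u_eq:
  assumes "x \<in> rrep F" shows "proj_u F 1 (unip F p) x = upper_part (Ad (unip F p) x)"
  by (simp add: proj_u_def orth_proj_rrep_ge[OF rrep_Ad[OF assms]])

lemma proj_u_infnorm:
  assumes "x \<in> rrep F" "p \<in> param_box 1" "infnorm x \<le> h"
  shows "infnorm (proj_u F 1 (unip F p) x) \<le> 16 * h"
  unfolding proj_u_eq[OF assms(1)]
proof (rule infnorm_le_entries)
  fix i j
  show "\<bar>upper_part (Ad (unip F p) x) $ i $ j\<bar> \<le> 16 * h"
    using Ad_entry_le[OF assms(2,3), of F i j] by (simp add: upper_part_def)
qed

lemma Ad_diff: "Ad (unip F p) (x - y) = Ad (unip F p) x - Ad (unip F p) y"
  by (simp add: Ad_def matrix_matrix_mult_def vec_eq_iff right_diff_distrib left_diff_distrib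
      sum_subtractf)

section \<open>Generic sequences in sets of positive measure\<close>

lemma det3_eq_quad: "det3 F a p q x = quad F (cross3 (par_vec F (p - a)) (par_vec F (q - a)) $ 1)
   (cross3 (par_vec F (p - a)) (par_vec F (q - a)) $ 2) (cross3 (par_vec F (p - a)) (par_vec F (q -
       a)) $ 3) a x"
proof -
  have "det3 F a p q x = par_vec F (x - a) \<bullet> cross3 (par_vec F (p - a)) (par_vec F (q - a))"
    using det3_cyclic[of F a x p q] by (simp add: det3_def)
  then show ?thesis by (simp add: inner_vec_def sum_3 quad_def par_vec_def mult.commute)
qed

text \<open>The first two components \<open>\<alpha>\<close> and \<open>\<beta>\<close> satisfy \<open>\<alpha> \<beta> = - N(u) N(v) N(v - u)\<close> for the split form
  and \<open>\<alpha>\<^sup>2 + \<beta>\<^sup>2 = 2 N(u) N(v) N(v - u)\<close> for the other, so they cannot both be small.\<close>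

lemma cross3_large:
  assumes \<tau>: "0 < \<tau>" "\<tau> \<le> 1"
    and N: "\<tau>^3 < \<bar>nform F u\<bar>" "\<tau>^3 < \<bar>nform F v\<bar>" "\<tau>^3 < \<bar>nform F (v - u)\<bar>"
  shows "\<tau>^5 < \<bar>cross3 (par_vec F u) (par_vec F v) $ 1\<bar> \<or> \<tau>^5 < \<bar>cross3 (par_vec F u) (par_vec F v)
      $ 2\<bar>"
proof (rule ccontr)
  define \<alpha> where "\<alpha> = cross3 (par_vec F u) (par_vec F v) $ 1"
  define \<beta> where "\<beta> = cross3 (par_vec F u) (par_vec F v) $ 2"
  assume "\<not> ?thesis"
  then have le: "\<bar>\<alpha>\<bar> \<le> \<tau>^5" "\<bar>\<beta>\<bar> \<le> \<tau>^5" by (auto simp: \<alpha>_def \<beta>_def)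
  have \<tau>3: "0 < \<tau>^3" using \<tau> by simp
  have "\<tau>^3 * \<tau>^3 * \<tau>^3 < \<bar>nform F u\<bar> * \<bar>nform F v\<bar> * \<bar>nform F (v - u)\<bar>"
    using N \<tau>3 by (intro mult_strict_mono mult_pos_pos order.strict_trans[OF \<tau>3 N(1)]
        order.strict_trans[OF \<tau>3 N(2)]) auto
  then have low: "\<tau>^9 < \<bar>nform F u * nform F v * nform F (v - u)\<bar>"
    by (simp add: abs_mult flip: power_add)
  have sq: "\<bar>\<alpha> * \<beta>\<bar> \<le> \<tau>^10" "\<alpha>\<^sup>2 \<le> \<tau>^10" "\<beta>\<^sup>2 \<le> \<tau>^10"
  proof -
    have "\<bar>\<alpha>\<bar> * \<bar>\<beta>\<bar> \<le> \<tau>^5 * \<tau>^5" "\<bar>\<alpha>\<bar> * \<bar>\<alpha>\<bar> \<le> \<tau>^5 * \<tau>^5" "\<bar>\<beta>\<bar> * \<bar>\<beta>\<bar> \<le> \<tau>^5 * \<tau>^5"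
      using le \<tau> by (intro mult_mono; simp)+
    then show "\<bar>\<alpha> * \<beta>\<bar> \<le> \<tau>^10" "\<alpha>\<^sup>2 \<le> \<tau>^10" "\<beta>\<^sup>2 \<le> \<tau>^10"
      by (simp_all add: abs_mult power2_eq_square flip: power_add)
  qed
  have "\<bar>nform F u * nform F v * nform F (v - u)\<bar> \<le> \<tau>^10"
  proof (cases F)
    case Form22
    have "nform F u * nform F v * nform F (v - u) = - (\<alpha> * \<beta>)"
      by (simp add: Form22 nform_def \<alpha>_def \<beta>_def cross3_def par_vec_def) (simp add: algebra_simps)
    then show ?thesis using sq(1) by simp
  next
    case Form31
    have "2 * (nform F u * nform F v * nform F (v - u)) = \<alpha>\<^sup>2 + \<beta>\<^sup>2"
      by (simp add: Form31 nform_def \<alpha>_def \<beta>_def cross3_def par_vec_def)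
        (simp add: field_simps power2_eq_square)
    moreover have "0 \<le> nform F u * nform F v * nform F (v - u)" by (simp add: Form31 nform_def)
    ultimately show ?thesis using sq by simp
  qed
  moreover have "\<tau>^10 \<le> \<tau>^9" using \<tau> by (intro power_decreasing) auto
  ultimately show False using low by linarith
qed

lemma finite_cover_outer_measure:
  assumes "finite I" "\<And>i. i \<in> I \<Longrightarrow> B i \<in> sets m" "\<And>i. i \<in> I \<Longrightarrow> emeasure m (B i) \<le> ennreal c"
    and "E \<subseteq> (\<Union>i\<in>I. B i)" "0 \<le> c"
  shows "outer_measure_of m E \<le> ennreal (real (card I) * c)"
proof -
  have "outer_measure_of m E \<le> outer_measure_of m (\<Union>i\<in>I. B i)"
    by (rule outer_measure_of_mono) fact
  also have "\<dots> = emeasure m (\<Union>i\<in>I. B i)"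
    using assms by (intro outer_measure_of_eq sets.finite_UN) auto
  also have "\<dots> \<le> (\<Sum>i\<in>I. emeasure m (B i))"
    using assms by (intro emeasure_subadditive_finite) auto
  also have "\<dots> \<le> (\<Sum>i\<in>I. ennreal c)" by (intro sum_mono assms)
  also have "\<dots> = ennreal (real (card I) * c)"
    using assms by (simp add: ennreal_mult ennreal_of_nat_eq_real_of_nat)
  finally show ?thesis .
qed

text \<open>Both conditions are imposed on increasing tuples of indices only, so that a sequence can be
  extended by avoiding finitely many sublevel sets, while every subsequence remains generic.\<close>

definition generic :: "form \<Rightarrow> real \<Rightarrow> nat \<Rightarrow> (nat \<Rightarrow> real \<times> real) \<Rightarrow> bool" where
  "generic F \<tau> n p \<longleftrightarrow>
     (\<forall>j<n. \<forall>i<j. \<tau>^3 < \<bar>nform F (p j - p i)\<bar>) \<and>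
     (\<forall>l<n. \<forall>k<l. \<forall>j<k. \<forall>i<j. \<tau>^8 < \<bar>det3 F (p i) (p j) (p k) (p l)\<bar>)"

text \<open>If no point of \<open>E\<close> were admissible, \<open>E\<close> would be covered by at most \<open>n + n^3\<close> sublevel sets,
  one for each index and one for each increasing triple of indices. That the polynomials for the
  triples have large coefficients follows from the conditions on pairs.\<close>

lemma generic_extend:
  assumes m: "haar_measure_on (ugroup F) m" and E: "E \<subseteq> param_box 1"
    and \<tau>: "0 < \<tau>" "40 * \<tau> < 1"
    and p: "generic F \<tau> n p" "\<forall>i<n. p i \<in> E"
    and large: "ennreal (real (n + n^3) * (2 * \<tau> * measure m (unip F ` param_box 2))) <
        outer_measure_of m (unip F ` E)"
  shows "\<exists>x\<in>E. generic F \<tau> (Suc n) (p(n := x))"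
proof (rule ccontr)
  assume none: "\<not> ?thesis"
  define c where "c = 2 * \<tau> * measure m (unip F ` param_box 2)"
  define K1 where "K1 i = {x \<in> param_box 1. \<bar>quad F 0 0 1 (p i) x\<bar> \<le> \<tau>^3}" for i
  define K2 where "K2 i j k = {x \<in> param_box 1. \<bar>det3 F (p i) (p j) (p k) x\<bar> \<le> \<tau>^8}" for i j k
  define I2 where "I2 = {(i, j, k). i < j \<and> j < k \<and> k < n}"
  have I2: "finite I2" "card I2 \<le> n^3"
  proof -
    have s: "I2 \<subseteq> {..<n} \<times> {..<n} \<times> {..<n}" by (auto simp: I2_def)
    then show "finite I2" by (rule finite_subset) auto
    from card_mono[OF _ s] show "card I2 \<le> n^3"
      by (simp add: card_cartesian_product power3_eq_cube)
  qed
  have \<tau>1: "\<tau> \<le> 1" using \<tau> by simp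
  have inbox: "p i \<in> param_box 1" if "i < n" for i using p(2) E that by auto
  have b1: "unip F ` K1 i \<in> sets m" "measure m (unip F ` K1 i) \<le> c" if "i < n" for i
  proof -
    have "40 * \<tau>^3 < \<tau>\<^sup>2 * \<bar>1\<bar>"
      using mult_strict_left_mono[OF \<tau>(2), of "\<tau>\<^sup>2"] \<tau>(1)
        by (simp add: eval_nat_numeral algebra_simps)
    then show "unip F ` K1 i \<in> sets m" "measure m (unip F ` K1 i) \<le> c"
      using quad_sublevel_measure[OF m inbox[OF that] \<tau>(1) \<tau>1, of "\<tau>^3" 0 0 1]
      by (simp_all add: K1_def c_def)
  qed
  have b2: "unip F ` K2 i j k \<in> sets m" "measure m (unip F ` K2 i j k) \<le> c"
    if "(i, j, k) \<in> I2" for i j k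
  proof -
    have ijk: "i < j" "j < k" "k < n" "i < k" "j < n" "i < n" using that by (auto simp: I2_def)
    define cr where "cr = cross3 (par_vec F (p j - p i)) (par_vec F (p k - p i))"
    have "\<tau>^5 < \<bar>cr $ 1\<bar> \<or> \<tau>^5 < \<bar>cr $ 2\<bar>"
      unfolding cr_def
      using p(1) ijk by (intro cross3_large \<tau> \<tau>1) (auto simp: generic_def)
    then have "\<tau>\<^sup>2 * \<tau>^5 < \<tau>\<^sup>2 * \<bar>cr $ 1\<bar> \<or> \<tau>\<^sup>2 * \<tau>^5 < \<tau>\<^sup>2 * \<bar>cr $ 2\<bar>"
      using \<tau>(1) mult_strict_left_mono[of _ _ "\<tau>\<^sup>2"] by (meson zero_less_power)
    moreover have "40 * \<tau>^8 < \<tau>\<^sup>2 * \<tau>^5"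
      using mult_strict_left_mono[OF \<tau>(2), of "\<tau>^7"] \<tau>(1)
        by (simp add: eval_nat_numeral algebra_simps)
    ultimately have big: "40 * \<tau>^8 < \<tau>\<^sup>2 * \<bar>cr $ 1\<bar> \<or> 40 * \<tau>^8 < \<tau>\<^sup>2 * \<bar>cr $ 2\<bar> \<or> 40 * \<tau>^8 < \<tau>\<^sup>2 *
        \<bar>cr $ 3\<bar>"
      by linarith
    show "unip F ` K2 i j k \<in> sets m" "measure m (unip F ` K2 i j k) \<le> c"
      unfolding K2_def det3_eq_quad cr_def[symmetric] c_def
      by (rule quad_sublevel_measure[OF m inbox[OF ijk(6)] \<tau>(1) \<tau>1 big])+
  qed
  define I where "I = Inl ` {..<n} \<union> Inr ` I2"
  define B where "B s = (case s of Inl i \<Rightarrow> unip F ` K1 i | Inr (i, j, k) \<Rightarrow> unip F ` K2 i j k)" for s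
  have fin: "emeasure m (unip F ` K) \<le> ennreal c"
    if "K \<subseteq> param_box 1" "measure m (unip F ` K) \<le> c" "unip F ` K \<in> sets m" for K
  proof -
    have "emeasure m (unip F ` K) \<le> emeasure m (unip F ` param_box 1)"
      using that haar_compact(1)[OF m compact_param_box] by (intro emeasure_mono) auto
    also have "\<dots> < \<infinity>" by (rule haar_compact(2)[OF m compact_param_box])
    finally show ?thesis using that by (subst emeasure_eq_ennreal_measure) (auto intro: ennreal_leI)
  qed
  have "outer_measure_of m (unip F ` E) \<le> ennreal (real (card I) * c)"
  proof (rule finite_cover_outer_measure[where B = B])
    show "finite I" using I2 by (simp add: I_def)
    show "B i \<in> sets m" if "i \<in> I" for i
      using that b1 b2 by (auto simp: I_def B_def)
    show "emeasure m (B i) \<le> ennreal c" if "i \<in> I" for i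
      using that b1 b2 by (auto simp: I_def B_def K1_def K2_def intro!: fin)
    show "0 \<le> c" using \<tau> by (simp add: c_def)
    show "unip F ` E \<subseteq> (\<Union>i\<in>I. B i)"
    proof
      fix u assume "u \<in> unip F ` E"
      then obtain x where x: "x \<in> E" "u = unip F x" by auto
      have "(\<exists>i<n. x \<in> K1 i) \<or> (\<exists>(i,j,k)\<in>I2. x \<in> K2 i j k)"
      proof (rule ccontr)
        assume not: "\<not> ?thesis"
        have "x \<in> param_box 1" using x E by auto
        then have far: "\<tau>^3 < \<bar>nform F (x - p i)\<bar>" if "i < n" for i
          using not that by (auto simp: K1_def quad_def not_le)
        have "\<tau>^8 < \<bar>det3 F (p i) (p j) (p k) x\<bar>" if "i < j" "j < k" "k < n" for i j k
          using not that \<open>x \<in> param_box 1\<close> by (auto simp: K2_def I2_def not_le)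
        with far p(1) have "generic F \<tau> (Suc n) (p(n := x))"
          by (auto simp: generic_def less_Suc_eq)
        with none x show False by blast
      qed
      then show "u \<in> (\<Union>i\<in>I. B i)"
        unfolding x I_def B_def by (fastforce simp: image_iff)
    qed
  qed
  also have "\<dots> \<le> ennreal (real (n + n^3) * c)"
  proof -
    have "card I \<le> n + n^3"
      using I2 card_Un_le[of "Inl ` {..<n}" "Inr ` I2"] by (simp add: I_def card_image)
    then show ?thesis using \<tau> by (intro ennreal_leI mult_right_mono) (auto simp: c_def simp del:
        of_nat_add of_nat_power)
  qed
  finally show False using large by (simp add: c_def)
qed

lemma generic_sequence:
  assumes m: "haar_measure_on (ugroup F) m" and E: "E \<subseteq> param_box 1"
    and \<tau>: "0 < \<tau>" "40 * \<tau> < 1"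
    and large: "ennreal (4 * real n^3 * \<tau> * measure m (unip F ` param_box 2)) < outer_measure_of m
        (unip F ` E)"
  shows "\<exists>p. generic F \<tau> n p \<and> (\<forall>i<n. p i \<in> E)"
proof -
  have "\<exists>p. generic F \<tau> k p \<and> (\<forall>i<k. p i \<in> E)" if "k \<le> n" for k
    using that
  proof (induction k)
    case 0
    then show ?case by (auto simp: generic_def)
  next
    case (Suc k)
    then obtain p where p: "generic F \<tau> k p" "\<forall>i<k. p i \<in> E" by auto
    have "k + k^3 \<le> 2 * n^3"
    proof -
      have "k \<le> n" using Suc by simp
      then have "k^3 \<le> n^3" by (rule power_mono) simp
      moreover have "k \<le> k^3" by (cases k) (auto simp: power3_eq_cube)
      ultimately show ?thesis by linarith
    qed
    then have "real (k + k^3) \<le> real (2 * n^3)" by (simp only: of_nat_le_iff)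
    then have "real (k + k^3) * (2 * \<tau> * measure m (unip F ` param_box 2))
        \<le> real (2 * n^3) * (2 * \<tau> * measure m (unip F ` param_box 2))"
      using \<tau> by (intro mult_right_mono) auto
    then have "ennreal (real (k + k^3) * (2 * \<tau> * measure m (unip F ` param_box 2)))
        \<le> ennreal (4 * real n^3 * \<tau> * measure m (unip F ` param_box 2))"
      by (intro ennreal_leI) (simp add: algebra_simps)
    also note large
    finally obtain x where x: "x \<in> E" "generic F \<tau> (Suc k) (p(k := x))"
      using generic_extend[OF m E \<tau> p] by blast
    moreover have "\<forall>i<Suc k. (p(k := x)) i \<in> E" using p x by (auto simp: less_Suc_eq)
    ultimately show ?case by blast
  qed
  then show ?thesis by simp
qed

section \<open>The inequality for five projections\<close>

lemma matrix_diff_distrib: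
  fixes A :: "'a::ring_1^'n^'m"
  shows "(A - B) ** C = A ** C - B ** C" "D ** (A - B) = D ** A - D ** B"
  by (simp_all add: matrix_matrix_mult_def vec_eq_iff left_diff_distrib right_diff_distrib
      sum_subtractf)

lemma rrep_diff: "x \<in> rrep F \<Longrightarrow> y \<in> rrep F \<Longrightarrow> x - y \<in> rrep F"
proof -
  have "transpose (x - y) = transpose x - transpose y" by (simp add: transpose_def vec_eq_iff)
  then show "x \<in> rrep F \<Longrightarrow> y \<in> rrep F \<Longrightarrow> x - y \<in> rrep F"
    by (simp add: rrep_iff matrix_diff_distrib trace_sub)
qed

lemma jet_le_add:
  assumes "jet_le F x p h" "jet_le F y p k" shows "jet_le F (x + y) p (h + k)"
proof -
  have "Ad (unip F p) (x + y) = Ad (unip F p) x + Ad (unip F p) y"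
    using Ad_diff[of F p "x + y" y] by (simp add: algebra_simps)
  then show ?thesis
    using assms by (auto simp: jet_le_def intro!: order_trans[OF abs_triangle_ineq add_mono])
qed

lemma jet_le_infnorm: "p \<in> param_box 1 \<Longrightarrow> infnorm x \<le> h \<Longrightarrow> jet_le F x p (16 * h)"
  by (auto simp: jet_le_def intro: Ad_entry_le)

lemma jet_le_proj:
  assumes "x \<in> rrep F" "y \<in> rrep F" "infnorm (proj_u F 1 (unip F p) x - proj_u F 1 (unip F p) y)
      \<le> h"
  shows "jet_le F (x - y) p h"
  unfolding jet_le_def
proof
  fix k :: 4 assume k: "k \<in> {2, 3, 4}"
  then have "upper_weight 1 k" by (auto simp: upper_weight_def)
  then have "Ad (unip F p) (x - y) $ 1 $ k
      = (proj_u F 1 (unip F p) x - proj_u F 1 (unip F p) y) $ 1 $ k"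
    by (simp add: Ad_diff proj_u_eq assms upper_part_def)
  then show "\<bar>Ad (unip F p) (x - y) $ 1 $ k\<bar> \<le> h"
    using order_trans[OF entry_le_infnorm assms(3)] by simp
qed

lemma edge_diff: "edge F (x - y) p q = edge F x p q - edge F y p q"
proof -
  have "(x - y) ** jmat F = x ** jmat F - y ** jmat F"
    by (rule matrix_diff_distrib(1))
  then show ?thesis
    by (simp add: edge_def sform_def matrix_vector_mult_diff_rdistrib inner_diff_right
        diff_divide_distrib)
qed

lemma card_floor_le_2:
  fixes f :: "'a \<Rightarrow> real"
  assumes "\<And>x y. x \<in> S \<Longrightarrow> y \<in> S \<Longrightarrow> \<bar>f x - f y\<bar> \<le> 1"
  shows "card ((\<lambda>x. \<lfloor>f x\<rfloor>) ` S) \<le> 2"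
proof (cases "finite ((\<lambda>x. \<lfloor>f x\<rfloor>) ` S) \<and> S \<noteq> {}")
  case True
  define k where "k = Min ((\<lambda>x. \<lfloor>f x\<rfloor>) ` S)"
  have "k \<in> (\<lambda>x. \<lfloor>f x\<rfloor>) ` S" unfolding k_def using True by (intro Min_in) auto
  then obtain y where y: "y \<in> S" "k = \<lfloor>f y\<rfloor>" by auto
  have "\<lfloor>f x\<rfloor> \<in> {k, k + 1}" if "x \<in> S" for x
  proof -
    have "k \<le> \<lfloor>f x\<rfloor>" unfolding k_def using True that by (intro Min_le) auto
    moreover have "\<lfloor>f x\<rfloor> \<le> k + 1" using assms[OF that y(1)] y(2) by linarith
    ultimately show ?thesis by auto
  qed
  then have "(\<lambda>x. \<lfloor>f x\<rfloor>) ` S \<subseteq> {k, k + 1}" by auto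
  from card_mono[OF _ this] show ?thesis by simp
qed auto

text \<open>Both triangles \<open>0 1 2\<close> and \<open>0 3 4\<close> are fed into \<open>entropy_triple_exchange\<close>, each with its
  shared number as \<open>z\<close> and the shared number of the other triangle as \<open>w\<close>. In the sum of the two
  inequalities the entropies of \<open>z\<close> and \<open>w\<close> cancel.\<close>

lemma five_projections:
  fixes A :: "nat \<Rightarrow> (real^4^4) set" and p :: "nat \<Rightarrow> real \<times> real"
  assumes \<delta>: "0 < \<delta>" and \<tau>: "0 < \<tau>" "\<tau> \<le> 1"
    and A: "\<And>i. i < 5 \<Longrightarrow> A i \<subseteq> unit_ball_rrep F"
    and p: "\<And>i. i < 5 \<Longrightarrow> p i \<in> param_box 1" "generic F \<tau> 5 p"
    and G: "finite G" "\<And>i. i < 5 \<Longrightarrow> G \<subseteq> cell \<delta> ` A i"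
    and B: "\<And>i. i < 5 \<Longrightarrow> real (covering_number \<delta> (proj_u F 1 (unip F (p i)) ` A i)) \<le> B" "0 < B"
  shows "(real (card G))\<^sup>2 \<le> 16 * ((68 * 10^12 / \<tau>^27 + 2) ^ 16)\<^sup>2 * B^6"
proof (cases "G = {}")
  case True
  then show ?thesis using B by simp
next
  case False
  define N where "N = real (card G)"
  have N: "0 < N" using False G by (simp add: N_def card_gt_0_iff)
  \<comment> \<open>a cell of \<open>G\<close> meets every \<open>A i\<close>, but possibly in different points; \<open>X = x 0\<close> represents the
    cell\<close>
  define x where "x i g = (SOME y. y \<in> A i \<and> cell \<delta> y = g)" for i g
  have x: "x i g \<in> A i" "cell \<delta> (x i g) = g" if "i < 5" "g \<in> G" for i g
  proof -
    have "\<exists>y. y \<in> A i \<and> cell \<delta> y = g" using G(2)[OF that(1)] that(2) by auto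
    from someI_ex[OF this] show "x i g \<in> A i" "cell \<delta> (x i g) = g" by (auto simp: x_def)
  qed
  have xr: "x i g \<in> rrep F" "infnorm (x i g) \<le> 1" if "i < 5" "g \<in> G" for i g
    using A[OF that(1)] x(1)[OF that] by (auto simp: unit_ball_rrep_def)
  have "\<exists>C. finite C \<and> real (card C)
      \<le> B \<and> proj_u F 1 (unip F (p i)) ` A i \<subseteq> (\<Union>c\<in>C. {y. infnorm (y - c) \<le> \<delta>})"
    if i: "i < 5" for i
  proof -
    have "infnorm y \<le> 16 * 1" if y: "y \<in> proj_u F 1 (unip F (p i)) ` A i" for y
    proof -
      obtain v where v: "v \<in> A i" "y = proj_u F 1 (unip F (p i)) v" using y by auto
      then have "v \<in> rrep F" "infnorm v \<le> 1" using A[OF i] by (auto simp: unit_ball_rrep_def)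
      from proj_u_infnorm[OF this(1) p(1)[OF i] this(2)] show ?thesis by (simp add: v(2))
    qed
    from covering_number_attained(1)[OF \<delta> this] B(1)[OF i] show ?thesis by metis
  qed
  then obtain C where C: "\<And>i. i < 5 \<Longrightarrow> finite (C i)" "\<And>i. i < 5 \<Longrightarrow> real (card (C i)) \<le> B"
    "\<And>i. i < 5 \<Longrightarrow> proj_u F 1 (unip F (p i)) ` A i \<subseteq> (\<Union>c\<in>C i. {y. infnorm (y - c) \<le> \<delta>})"
    by metis
  \<comment> \<open>the projection at \<open>p i\<close>, discretised by the centres of an optimal cover\<close>
  define D where "D i g = (SOME c. c \<in> C i \<and> infnorm (proj_u F 1 (unip F (p i)) (x i g) - c)
      \<le> \<delta>)" for i g
  have D: "D i g \<in> C i" "infnorm (proj_u F 1 (unip F (p i)) (x i g) - D i g) \<le> \<delta>"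
    if "i < 5" "g \<in> G" for i g
  proof -
    have "\<exists>c. c \<in> C i \<and> infnorm (proj_u F 1 (unip F (p i)) (x i g) - c) \<le> \<delta>"
      using C(3)[OF that(1)] x(1)[OF that] by auto
    from someI_ex[OF this] show "D i g \<in> C i" "infnorm (proj_u F 1 (unip F (p i)) (x i g) - D i g)
        \<le> \<delta>"
      by (auto simp: D_def)
  qed
  have ent: "entropy G (D i) \<le> N * ln B" if i: "i < 5" for i
  proof -
    have sub: "D i ` G \<subseteq> C i" using D(1)[OF i] by auto
    have "0 < card (D i ` G)" using False G by (simp add: card_gt_0_iff)
    moreover have "real (card (D i ` G)) \<le> B"
      using card_mono[OF C(1)[OF i] sub] C(2)[OF i] by linarith
    ultimately have "ln (real (card (D i ` G))) \<le> ln B" by simp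
    then have "N * ln (real (card (D i ` G))) \<le> N * ln B" using N by (intro mult_left_mono) auto
    with entropy_le_ln_card[OF G(1), of "D i"] show ?thesis by (simp add: N_def)
  qed
  define X where "X = x 0"
  have Xr: "X g \<in> rrep F" if "g \<in> G" for g using xr(1)[of 0] that by (simp add: X_def)
  define h where "h = 34 * \<delta>"
  have h: "0 < h" using \<delta> by (simp add: h_def)
  \<comment> \<open>passing from \<open>x i\<close> to \<open>X\<close> costs \<open>16 \<delta>\<close> for each cell, and sharing a centre costs \<open>2 \<delta>\<close>\<close>
  have jet: "jet_le F (X g - X g') (p i) h" if "i < 5" "g \<in> G" "g' \<in> G" "D i g = D i g'" for i g g'
  proof -
    have near: "infnorm (x 0 u - x i u) \<le> \<delta>" "infnorm (x i u - x 0 u) \<le> \<delta>" if "u \<in> G" for u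
      using x(2)[of 0 u] x(2)[of i u] that \<open>i < 5\<close> by (auto intro!: cell_eq_imp[OF \<delta>])
    have "infnorm (proj_u F 1 (unip F (p i)) (x i g) - proj_u F 1 (unip F (p i)) (x i g')) \<le> 2 * \<delta>"
      using infnorm_triangle[of "proj_u F 1 (unip F (p i)) (x i g) - D i g"
        "D i g' - proj_u F 1 (unip F (p i)) (x i g')"]
        D(2)[OF that(1,2)] D(2)[OF that(1,3)] that(4) by (simp add: infnorm_sub[of "D i g'"])
    then have "jet_le F (x i g - x i g') (p i) (2 * \<delta>)"
      using xr that by (intro jet_le_proj) auto
    from jet_le_add[OF jet_le_add[OF jet_le_infnorm[OF p(1)[OF that(1)] near(1)[OF that(2)], of F]
        this]
      jet_le_infnorm[OF p(1)[OF that(1)] near(2)[OF that(3)], of F]]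
    show ?thesis by (simp add: X_def h_def)
  qed
  have nn: "\<tau>^3 < \<bar>nform F (p i - p j)\<bar>" if "i < 5" "j < 5" "i \<noteq> j" for i j
  proof (cases "i < j")
    case True
    then have "\<tau>^3 < \<bar>nform F (p j - p i)\<bar>" using p(2) that by (simp add: generic_def)
    then show ?thesis by (simp add: nform_diff_commute[of F "p i"])
  next
    case False
    with that have "j < i" by simp
    then show ?thesis using p(2) that by (simp add: generic_def)
  qed
  have \<nu>: "0 < \<tau>^3" using \<tau> by simp
  define \<zeta> where "\<zeta> i j k z = edge F z (p i) (p j) - edge F z (p i) (p k)" for i j k z
  have \<zeta>_diff: "\<zeta> i j k (z - z') = \<zeta> i j k z - \<zeta> i j k z'" for i j k z z'
    by (simp add: \<zeta>_def edge_diff)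
  have \<zeta>1: "\<bar>\<zeta> i j k (X g - X g')\<bar> \<le> 10 * h / \<tau>^3"
    if "i < 5" "j < 5" "k < 5" "i \<noteq> j" "i \<noteq> k" "g \<in> G" "g' \<in> G" "D i g = D i g'" for i j k g g'
    unfolding \<zeta>_def
    by (rule edge_diff_le[OF jet[OF that(1,6,7,8)]]) (use that p(1) nn \<nu> in auto)
  \<comment> \<open>the triangle relation: the number seen at the vertex \<open>p i\<close> is also seen at \<open>p j\<close> and \<open>p k\<close>
    together\<close>
  have \<zeta>2: "\<bar>\<zeta> i j k (X g - X g')\<bar> \<le> 20 * h / \<tau>^3"
    if "i < 5" "j < 5" "k < 5" "i \<noteq> j" "i \<noteq> k" "j \<noteq> k" "g \<in> G" "g' \<in> G" "D j g = D j g'" "D k g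
        = D k g'" for i j k g g'
  proof -
    have r: "X g - X g' \<in> rrep F" using Xr that by (intro rrep_diff) auto
    have "\<zeta> i j k (X g - X g') = \<zeta> j i k (X g - X g') + \<zeta> k j i (X g - X g')"
      using edge_commute[OF r, of "p i" "p j"] edge_commute[OF r, of "p j"
        "p k"] edge_commute[OF r, of "p i" "p k"]
      by (simp add: \<zeta>_def)
    moreover have "\<bar>\<zeta> j i k (X g - X g')\<bar> \<le> 10 * h / \<tau>^3" "\<bar>\<zeta> k j i (X g - X g')\<bar> \<le> 10 * h / \<tau>^3"
      using that by (auto intro!: \<zeta>1)
    ultimately show ?thesis by linarith
  qed
  define s where "s = 20 * h / \<tau>^3"
  have s: "0 < s" using h \<nu> by (simp add: s_def)
  define z where "z i j k g = \<lfloor>\<zeta> i j k (X g) / s\<rfloor>" for i j k g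
  have two: "card (z i j k ` S) \<le> 2"
    if "\<And>g g'. g \<in> S \<Longrightarrow> g' \<in> S \<Longrightarrow> \<bar>\<zeta> i j k (X g - X g')\<bar> \<le> s" for i j k S
    unfolding z_def
  proof (rule card_floor_le_2)
    fix g g' assume "g \<in> S" "g' \<in> S"
    from that[OF this] show "\<bar>\<zeta> i j k (X g) / s - \<zeta> i j k (X g') / s\<bar> \<le> 1"
      using s unfolding \<zeta>_diff by (simp add: diff_divide_distrib[symmetric] abs_divide)
  qed
  define Q where "Q = (68 * 10^12 / \<tau>^27 + 2) ^ 16"
  define c where "c = nat \<lfloor>Q\<rfloor>"
  have Q: "1 \<le> Q" unfolding Q_def using \<tau> by (intro one_le_power) (simp add: add_increasing)
  have c: "real c \<le> Q" "0 < real c" using Q by (auto simp: c_def le_nat_iff le_floor_iff)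
  have few: "card S \<le> c" if "S \<subseteq> G" and
    R: "\<And>g g'. g \<in> S \<Longrightarrow> g' \<in> S \<Longrightarrow> infnorm (X g - X g') \<le> 10^12 * h / \<tau>^27" for S
  proof -
    define R where "R = 10^12 * h / \<tau>^27"
    have "cell \<delta> ` X ` S = S"
      using x(2)[of 0] \<open>S \<subseteq> G\<close> by (force simp: X_def image_image)
    moreover have "real (card (cell \<delta> ` X ` S)) \<le> (2 * R / \<delta> + 2) ^ DIM(real^4^4)"
      by (rule cells_of_small_set(2)[OF \<delta>]) (use h \<tau> R in \<open>auto simp: R_def\<close>)
    moreover have "2 * R / \<delta> = 68 * 10^12 / \<tau>^27" using \<delta> by (simp add: R_def h_def)
    ultimately have "real (card S) \<le> Q" by (simp add: Q_def)
    then show ?thesis by (simp add: c_def le_nat_iff le_floor_iff)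
  qed
  have sep: "infnorm (X g - X g') \<le> 10^12 * h / \<tau>^27"
    if idx: "i2 < 5" "i3 < 5" "i4 < 5" "i5 < 5" "distinct [0, i2, i3, i4, i5 :: nat]"
      and d: "\<tau>^8 < \<bar>det3 F (p 0) (p i2) (p i3) (p i4)\<bar>" "\<tau>^8 < \<bar>det3 F (p 0) (p i2) (p i3) (p i5)\<bar>"
      and g: "g \<in> G" "g' \<in> G" and eq: "D 0 g = D 0 g'" "D i2 g = D i2 g'" "D i3 g = D i3 g'"
      and zeq: "z i4 i5 0 g = z i4 i5 0 g'" for i2 i3 i4 i5 g g'
  proof -
    have ne: "i2 \<noteq> 0" "i3 \<noteq> 0" "i4 \<noteq> 0" "i5 \<noteq> 0" "i2 \<noteq> i3" "i2 \<noteq> i4" "i2 \<noteq> i5"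
      "i3 \<noteq> i4" "i3 \<noteq> i5" "i4 \<noteq> i5" using idx(5) by auto
    have "\<bar>\<zeta> i4 i5 0 (X g) / s - \<zeta> i4 i5 0 (X g') / s\<bar> \<le> 1" using zeq unfolding z_def by linarith
    then have "\<bar>\<zeta> i4 i5 0 (X g - X g')\<bar> \<le> s"
      using s unfolding \<zeta>_diff by (simp add: diff_divide_distrib[symmetric] abs_divide)
    then have Z: "\<bar>edge F (X g - X g') (p i4) (p i5) - edge F (X g - X g') (p i4) (p 0)\<bar>
        \<le> 20 * h / \<tau>^3"
      by (simp add: \<zeta>_def s_def)
    show ?thesis
    proof (rule separation[OF rrep_diff[OF Xr[OF g(1)] Xr[OF g(2)]] \<tau> _ _ _ _ _ _ _ _ _ _ _ _ _ d _
        _ _ Z])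
      show "jet_le F (X g - X g') (p 0) h" "jet_le F (X g - X g') (p i2) h"
        "jet_le F (X g - X g') (p i3) h"
        using jet[of 0] jet[of i2] jet[of i3] idx g eq by simp_all
    qed (use p(1) nn idx ne ne[symmetric] in simp_all)
  qed
  have det: "\<tau>^8 < \<bar>det3 F (p i) (p j) (p k) (p l)\<bar>" if "i < j" "j < k" "k < l" "l < 5" for i j k l
    using p(2) that by (simp add: generic_def)
  have dets: "\<tau>^8 < \<bar>det3 F (p 0) (p 1) (p 2) (p 3)\<bar>" "\<tau>^8 < \<bar>det3 F (p 0) (p 1) (p 2) (p 4)\<bar>"
    "\<tau>^8 < \<bar>det3 F (p 0) (p 3) (p 4) (p 1)\<bar>" "\<tau>^8 < \<bar>det3 F (p 0) (p 3) (p 4) (p 2)\<bar>"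
    using det[of 0 1 2 3] det[of 0 1 2 4] det[of 0 1 3 4] det[of 0 2 3 4]
      det3_cyclic[of F "p 0" "p 1" "p 3" "p 4"] det3_cyclic[of F "p 0" "p 2" "p 3" "p 4"]
        by simp_all
  have "10 * h / \<tau>^3 \<le> s" using h \<nu> by (simp add: s_def divide_right_mono)
  note le_s = order_trans[OF \<zeta>1 this]
  have "entropy G (\<lambda>g. g) + entropy G (z 1 2 0)
      \<le> entropy G (D 0) + entropy G (D 1) + entropy G (D 2)
      + entropy G (z 3 4 0) + real (card G) * (2 * ln 2 + ln (real c))"
  proof (rule entropy_triple_exchange[OF G(1)])
    fix g assume g: "g \<in> G"
    show "card (z 1 2 0 ` {y \<in> G. D 1 y = D 1 g}) \<le> 2"
      by (rule two, rule le_s) auto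
    show "card (z 1 2 0 ` {y \<in> G. D 0 y = D 0 g \<and> D 2 y = D 2 g}) \<le> 2"
      by (rule two) (auto simp: s_def intro!: \<zeta>2)
    show "card {y \<in> G. D 0 y = D 0 g \<and> D 2 y = D 2 g \<and> D 1 y = D 1 g \<and> z 3 4 0 y = z 3 4 0 g} \<le> c"
    proof (rule few)
      fix u v
      assume "u \<in> {y \<in> G. D 0 y = D 0 g \<and> D 2 y = D 2 g \<and> D 1 y = D 1 g \<and> z 3 4 0 y = z 3 4 0 g}"
        "v \<in> {y \<in> G. D 0 y = D 0 g \<and> D 2 y = D 2 g \<and> D 1 y = D 1 g \<and> z 3 4 0 y = z 3 4 0 g}"
      then show "infnorm (X u - X v) \<le> 10^12 * h / \<tau>^27"
        by (intro sep[of 1 2 3 4] dets) auto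
    qed auto
  qed
  moreover have "entropy G (\<lambda>g. g) + entropy G (z 3 4 0)
      \<le> entropy G (D 0) + entropy G (D 3) + entropy G (D 4)
      + entropy G (z 1 2 0) + real (card G) * (2 * ln 2 + ln (real c))"
  proof (rule entropy_triple_exchange[OF G(1)])
    fix g assume g: "g \<in> G"
    show "card (z 3 4 0 ` {y \<in> G. D 3 y = D 3 g}) \<le> 2"
      by (rule two, rule le_s) auto
    show "card (z 3 4 0 ` {y \<in> G. D 0 y = D 0 g \<and> D 4 y = D 4 g}) \<le> 2"
      by (rule two) (auto simp: s_def intro!: \<zeta>2)
    show "card {y \<in> G. D 0 y = D 0 g \<and> D 4 y = D 4 g \<and> D 3 y = D 3 g \<and> z 1 2 0 y = z 1 2 0 g} \<le> c"
    proof (rule few)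
      fix u v
      assume "u \<in> {y \<in> G. D 0 y = D 0 g \<and> D 4 y = D 4 g \<and> D 3 y = D 3 g \<and> z 1 2 0 y = z 1 2 0 g}"
        "v \<in> {y \<in> G. D 0 y = D 0 g \<and> D 4 y = D 4 g \<and> D 3 y = D 3 g \<and> z 1 2 0 y = z 1 2 0 g}"
      then show "infnorm (X u - X v) \<le> 10^12 * h / \<tau>^27"
        by (intro sep[of 3 4 1 2] dets) auto
    qed auto
  qed
  ultimately have "2 * (N * ln N) \<le> 6 * (N * ln B) + N * (4 * ln 2 + 2 * ln (real c))"
    using ent[of 0] ent[of 1] ent[of 2] ent[of 3] ent[of 4] entropy_id[OF G(1)]
    by (simp add: N_def algebra_simps)
  then have "N * (2 * ln N) \<le> N * (6 * ln B + 4 * ln 2 + 2 * ln (real c))"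
    by (simp add: algebra_simps)
  then have "2 * ln N \<le> 6 * ln B + 4 * ln 2 + 2 * ln (real c)" using N by simp
  also have "\<dots> = ln (B^6 * 2^4 * (real c)\<^sup>2)"
    using B(2) c(2) ln_realpow[of "2::real" 4] by (simp add: ln_mult ln_realpow)
  finally have "ln (N\<^sup>2) \<le> ln (B^6 * 2^4 * (real c)\<^sup>2)" using N by (simp add: ln_realpow)
  then have "N\<^sup>2 \<le> B^6 * 2^4 * (real c)\<^sup>2" using N B(2) c(2) by (subst (asm) ln_le_cancel_iff) auto
  also have "\<dots> \<le> B^6 * 2^4 * Q\<^sup>2"
    using c B by (intro mult_left_mono power_mono) auto
  finally show ?thesis by (simp add: N_def Q_def algebra_simps)
qed

section \<open>The exceptional set\<close>

lemma generic_subsequence: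
  assumes "generic F \<tau> n p" "sorted_wrt (<) js" "\<And>i. i \<in> set js \<Longrightarrow> i < n"
  shows "generic F \<tau> (length js) (\<lambda>k. p (js ! k))"
  unfolding generic_def
proof (intro conjI allI impI)
  have lt: "js ! i < js ! j" if "i < j" "j < length js" for i j
    using sorted_wrt_nth_less[OF assms(2) that] .
  have n: "js ! j < n" if "j < length js" for j using assms(3) that by simp
  show "\<tau>^3 < \<bar>nform F (p (js ! j) - p (js ! i))\<bar>" if "j < length js" "i < j" for i j
    using assms(1) lt[OF that(2,1)] n[OF that(1)] by (simp add: generic_def)
  show "\<tau>^8 < \<bar>det3 F (p (js ! i)) (p (js ! j)) (p (js ! k)) (p (js ! l))\<bar>"
    if "l < length js" "k < l" "j < k" "i < j" for i j k l
    using assms(1) lt[of i j] lt[of j k] lt[of k l] n[of l] that by (simp add: generic_def)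
qed

lemma ubox_eq: "ubox F = unip F ` param_box 1"
  by (force simp: ubox_def unip_def param_box_def image_iff)

text \<open>The accounting of powers of \<open>t\<close>: with \<open>\<tau> = t^5\<close> the separation costs \<open>t\<close> to the power \<open>- 5 *
  27 * 16 * 2 = - 4320\<close>, the number \<open>n^10\<close> of choices costs \<open>- 10\<close>, the density yields \<open>2\<close> on the
  other side, and the projections gain \<open>6 * 723 = 4338\<close>. The balance \<open>4338 - 4320 - 10 - 2 = 6\<close> is
  positive.\<close>

lemma parameter_contradiction:
  fixes t L a N n :: real
  assumes t: "0 < t" "t < 1" and L: "1 \<le> L" and a: "0 < a" and n: "0 \<le> n" "n \<le> 9 * L / t"
    and low: "t / L * a \<le> 2 * n^5 * N"
    and up: "N\<^sup>2 \<le> 16 * ((68 * 10^12 / (t^5)^27 + 2) ^ 16)\<^sup>2 * (t^723 * a powr (1/3)) ^ 6"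
    and small: "t * (64 * (9 * L)^10 * 10^448 * L\<^sup>2) < 1"
  shows False
proof -
  have p: "t^i \<le> 1" for i using t by (simp add: power_le_one)
  have Q: "68 * 10^12 / (t^5)^27 + 2 \<le> 10^14 / t^135"
  proof -
    have "2 * t^135 \<le> 2" using p[of 135] by simp
    then have "68 * 10^12 + 2 * t^135 \<le> 10^14" by simp
    then have "(68 * 10^12 + 2 * t^135) / t^135 \<le> 10^14 / t^135"
      using t by (intro divide_right_mono) auto
    then show ?thesis using t by (simp add: add_divide_distrib flip: power_mult)
  qed
  have "((68 * 10^12 / (t^5)^27 + 2) ^ 16)\<^sup>2 \<le> ((10^14 / t^135) ^ 16)\<^sup>2"
    using t by (intro power_mono Q) auto
  also have "\<dots> = 10^448 / t^4320" by (simp only: power_divide flip: power_mult) simp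
  finally have Q2: "((68 * 10^12 / (t^5)^27 + 2) ^ 16)\<^sup>2 \<le> 10^448 / t^4320" .
  have a6: "(a powr (1/3)) ^ 6 = a\<^sup>2"
  proof -
    have "(a powr (1/3)) ^ 6 = (a powr (1/3)) powr real 6"
      using a by (intro powr_realpow[symmetric]) simp
    also have "\<dots> = a powr real 2" by (simp add: powr_powr)
    also have "\<dots> = a\<^sup>2" using a by (rule powr_realpow)
    finally show ?thesis .
  qed
  define K :: real where "K = 10^448"
  have K: "0 \<le> K" unfolding K_def by (rule zero_le_power) simp
  have N_up: "N\<^sup>2 \<le> 16 * K * t^18 * a\<^sup>2"
  proof -
    have "N\<^sup>2 \<le> 16 * (K / t^4320) * (t^723 * a powr (1/3)) ^ 6"
      by (rule order_trans[OF up], intro mult_right_mono mult_left_mono Q2[folded K_def]) (use t in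
          simp_all)
    also have "(t^723 * a powr (1/3)) ^ 6 = t^4320 * t^18 * a\<^sup>2"
      by (simp only: power_mult_distrib a6 flip: power_mult power_add) simp
    also have "16 * (K / t^4320) * (t^4320 * t^18 * a\<^sup>2) = 16 * K * t^18 * a\<^sup>2"
    proof -
      have cancel: "16 * (K / w) * (w * y * z) = 16 * K * y * z" if "w \<noteq> 0" for w y z :: real
        using that by simp
      show ?thesis by (rule cancel) (use t in simp)
    qed
    finally show ?thesis .
  qed
  have "(t / L * a)\<^sup>2 \<le> (2 * n^5 * N)\<^sup>2"
    using low t L a by (intro power_mono) auto
  also have "\<dots> = 4 * n^10 * N\<^sup>2" by (simp add: power_mult_distrib flip: power_mult)
  also have "\<dots> \<le> 4 * (9 * L / t)^10 * (16 * K * t^18 * a\<^sup>2)"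
    using n K N_up by (intro mult_mono power_mono) auto
  also have "\<dots> = (64 * (9 * L)^10 * K * (t^18 / t^10)) * a\<^sup>2"
    by (simp only: power_divide) simp
  also have "t^18 / t^10 = t^8"
    using t power_diff[of t 10 18] by simp
  finally have "(t\<^sup>2 / L\<^sup>2) * a\<^sup>2 \<le> (64 * (9 * L)^10 * K * t^8) * a\<^sup>2"
    by (simp only: power_mult_distrib power_divide)
  then have "t\<^sup>2 / L\<^sup>2 \<le> 64 * (9 * L)^10 * K * t^8"
    using a by (simp only: mult_le_cancel_right_pos zero_less_power)
  then have "t\<^sup>2 \<le> 64 * (9 * L)^10 * K * t^8 * L\<^sup>2"
    using L by (simp only: pos_divide_le_eq zero_less_power)
  also have "\<dots> = t\<^sup>2 * t^5 * (t * (64 * (9 * L)^10 * K * L\<^sup>2))"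
  proof -
    have "t^8 = t\<^sup>2 * t^5 * t" by (simp add: eval_nat_numeral)
    then show ?thesis by (simp only: mult_ac)
  qed
  also have "\<dots> < t\<^sup>2 * t^5 * 1"
    using t small by (intro mult_strict_left_mono) (auto simp only: K_def zero_less_power
        mult_pos_pos)
  also have "\<dots> \<le> t\<^sup>2 * 1" using p[of 5] t by simp
  finally show False by simp
qed

text \<open>The exponent \<open>5\<close> in \<open>\<tau> = t^5\<close> is dictated by \<open>generic_sequence\<close>: with \<open>n\<close> of the order of \<open>1
  / t\<close>, the product \<open>n^3 \<tau>\<close> has to stay below \<open>t\<close> by a margin that absorbs constants. The constant
  \<open>L\<close> compares numbers of cells with covering numbers in dimension sixteen.\<close>

lemma exceptional_set_measure_le:
  assumes m: "haar_measure_on (ugroup F) m" and A: "A \<subseteq> unit_ball_rrep F"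
    and \<delta>: "0 < \<delta>" and t: "t = \<delta> powr \<epsilon>" "t < 1"
    and L: "L = 6 ^ 16"
    and small1: "t * (64 * (9 * L)^10 * 10^448 * L\<^sup>2) < 1"
    and small2: "t * (4 * (9 * L)^3 * measure m (unip F ` param_box 2)) < 1"
  shows "outer_measure_of m (exceptional_set F 723 \<epsilon> \<delta> A) \<le> ennreal t"
proof (rule ccontr)
  assume "\<not> ?thesis"
  then have big: "ennreal t < outer_measure_of m (exceptional_set F 723 \<epsilon> \<delta> A)" by simp
  have t0: "0 < t" using \<delta> t by simp
  have tM: "\<delta> powr (723 * \<epsilon>) = t^723"
    using t0 by (simp add: t powr_powr mult.commute flip: powr_realpow)
  define E where "E = {p \<in> param_box 1. unip F p \<in> exceptional_set F 723 \<epsilon> \<delta> A}"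
  have UE: "unip F ` E = exceptional_set F 723 \<epsilon> \<delta> A"
    unfolding E_def by (auto simp: exceptional_set_def ubox_eq)
  define \<theta> where "\<theta> = t / L"
  have L1: "1 \<le> L" by (simp add: L)
  have \<theta>: "0 < \<theta>" "\<theta> \<le> 1" using t0 t L1 by (auto simp: \<theta>_def)
  define n where "n = nat \<lceil>8 / \<theta>\<rceil>"
  have n: "8 / \<theta> \<le> real n" "real n \<le> 9 * L / t"
  proof -
    show "8 / \<theta> \<le> real n" unfolding n_def by linarith
    have "real n \<le> 8 / \<theta> + 1" using \<theta> unfolding n_def by (simp add: of_nat_nat)
    also have "\<dots> \<le> 9 / \<theta>" using \<theta> by (simp add: field_simps)
    finally show "real n \<le> 9 * L / t" using L1 t0 by (simp add: \<theta>_def)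
  qed
  define \<tau> where "\<tau> = t^5"
  have \<tau>: "0 < \<tau>" "40 * \<tau> < 1"
  proof -
    show "0 < \<tau>" using t0 by (simp add: \<tau>_def)
    have "t^5 \<le> t^1" using t0 t by (intro power_decreasing) auto
    then have "40 * \<tau> \<le> t * 40" by (simp add: \<tau>_def)
    also have "\<dots> \<le> t * (64 * (9 * L)^10 * 10^448 * L\<^sup>2)"
      using t0 by (intro mult_left_mono) (simp_all add: L)
    finally show "40 * \<tau> < 1" using small1 by linarith
  qed
  have large: "ennreal (4 * real n^3 * \<tau> * measure m (unip F ` param_box 2)) < outer_measure_of m
      (unip F ` E)"
  proof -
    have "4 * real n^3 * \<tau> * measure m (unip F ` param_box 2)
        \<le> 4 * (9 * L / t)^3 * \<tau> * measure m (unip F ` param_box 2)"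
      using n \<tau> by (intro mult_right_mono mult_left_mono power_mono) auto
    also have "\<dots> = t * (t * (4 * (9 * L)^3 * measure m (unip F ` param_box 2)))"
      using t0 by (simp add: \<tau>_def power_divide) (simp add: eval_nat_numeral)
    also have "\<dots> \<le> t * 1" using small2 t0 by (intro mult_left_mono) auto
    finally have "ennreal (4 * real n^3 * \<tau> * measure m (unip F ` param_box 2)) \<le> ennreal t"
      by (intro ennreal_leI) simp
    also note big
    finally show ?thesis by (simp add: UE)
  qed
  have "E \<subseteq> param_box 1" by (auto simp: E_def)
  from generic_sequence[OF m this \<tau> large]
  obtain p where p: "generic F \<tau> n p" "\<And>i. i < n \<Longrightarrow> p i \<in> E" by blast
  have "\<exists>A'\<subseteq>A. t * real (covering_number \<delta> A) \<le> real (covering_number \<delta> A') \<and>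
      real (covering_number \<delta> (proj_u F 1 (unip F (p i)) ` A')) < t^723 * real (covering_number \<delta> A)
          powr (1/3)"
    if "i < n" for i
    using p(2)[OF that] by (auto simp: E_def exceptional_set_def tM t(1))
  then obtain A' where A': "\<And>i. i < n \<Longrightarrow> A' i \<subseteq> A"
    "\<And>i. i < n \<Longrightarrow> t * real (covering_number \<delta> A) \<le> real (covering_number \<delta> (A' i))"
    "\<And>i. i < n \<Longrightarrow> real (covering_number \<delta> (proj_u F 1 (unip F (p i)) ` A' i)) < t^723 * real
        (covering_number \<delta> A) powr (1/3)"
    by metis
  define a where "a = real (covering_number \<delta> A)"
  have bd: "infnorm x \<le> 1" if "x \<in> A" for x using that A by (auto simp: unit_ball_rrep_def)
  have npos: "0 < n" using n(1) \<theta> by (cases n) (auto simp: field_simps)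
  have a: "0 < a"
  proof -
    have "0 < t^723 * a powr (1/3)"
      using A'(3)[OF npos] by (simp add: a_def order.strict_trans1[OF of_nat_0_le_iff])
    then show ?thesis by (cases "a = 0") (auto simp: a_def)
  qed
  define \<Gamma> where "\<Gamma> = cell \<delta> ` A"
  have cells: "finite \<Gamma>" and \<Gamma>a: "real (card \<Gamma>) \<le> L * a"
    using cells_le_covering_number[OF \<delta>, of A 1] bd by (simp_all add: \<Gamma>_def L a_def)
  have a\<Gamma>: "a \<le> real (card \<Gamma>)"
    using covering_number_attained(2)[OF \<delta>, of A 1] bd by (simp add: a_def \<Gamma>_def)
  have "\<Gamma> \<noteq> {}" using a a\<Gamma> by auto
  have "\<exists>I. I \<subseteq> {..<n} \<and> card I
      = 5 \<and> \<theta> * real (card \<Gamma>) \<le> 2 * real n^5 * real (card {\<gamma>\<in>\<Gamma>. \<forall>i\<in>I. \<gamma> \<in> cell \<delta> ` A' i})"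
  proof (rule popular_five[OF cells \<open>\<Gamma> \<noteq> {}\<close>])
    fix i assume i: "i < n"
    show "cell \<delta> ` A' i \<subseteq> \<Gamma>" using A'(1)[OF i] by (auto simp: \<Gamma>_def)
    have "\<theta> * real (card \<Gamma>) \<le> \<theta> * (L * a)" using \<Gamma>a \<theta> by (intro mult_left_mono) auto
    also have "\<dots> = t * a" using L1 by (simp add: \<theta>_def)
    also have "\<dots> \<le> real (covering_number \<delta> (A' i))" using A'(2)[OF i] by (simp add: a_def)
    also have "\<dots> \<le> real (card (cell \<delta> ` A' i))"
      using covering_number_attained(2)[OF \<delta>, of "A' i" 1] bd A'(1)[OF i] by auto
    finally show "\<theta> * real (card \<Gamma>) \<le> real (card (cell \<delta> ` A' i))" .
  next
    show "8 \<le> \<theta> * real n" using n(1) \<theta> by (simp add: field_simps)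
  qed (rule \<theta>)
  then obtain I where I: "I \<subseteq> {..<n}" "card I = 5"
    "\<theta> * real (card \<Gamma>) \<le> 2 * real n^5 * real (card {\<gamma>\<in>\<Gamma>. \<forall>i\<in>I. \<gamma> \<in> cell \<delta> ` A' i})" by blast
  define G where "G = {\<gamma>\<in>\<Gamma>. \<forall>i\<in>I. \<gamma> \<in> cell \<delta> ` A' i}"
  have fI: "finite I" using I(1) by (rule finite_subset) simp
  define js where "js = sorted_list_of_set I"
  have js: "set js = I" "sorted_wrt (<) js" "length js = 5"
    using fI I(2) by (simp_all add: js_def strict_sorted_list_of_set)
  have isI: "js ! k \<in> I" "js ! k < n" if "k < 5" for k
    using that js I(1) nth_mem[of k js] by auto
  define B where "B = t^723 * a powr (1/3)"
  have "(real (card G))\<^sup>2 \<le> 16 * ((68 * 10^12 / \<tau>^27 + 2) ^ 16)\<^sup>2 * B^6"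
  proof (rule five_projections[where F = F and \<delta> = \<delta> and A = "\<lambda>k. A' (js ! k)" and p
      = "\<lambda>k. p (js ! k)"])
    show "generic F \<tau> 5 (\<lambda>k. p (js ! k))"
      using generic_subsequence[OF p(1) js(2)] js I(1) by auto
    show "finite G" using cells by (simp add: G_def)
    show "0 < B" using t0 a by (simp add: B_def)
    show "\<tau> \<le> 1" using \<tau> by simp
    fix k :: nat assume k: "k < 5"
    show "A' (js ! k) \<subseteq> unit_ball_rrep F" using A'(1)[OF isI(2)[OF k]] A by blast
    show "p (js ! k) \<in> param_box 1" using p(2)[OF isI(2)[OF k]] by (simp add: E_def)
    show "G \<subseteq> cell \<delta> ` A' (js ! k)" using isI(1)[OF k] by (auto simp: G_def)
    show "real (covering_number \<delta> (proj_u F 1 (unip F (p (js ! k))) ` A' (js ! k))) \<le> B"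
      using A'(3)[OF isI(2)[OF k]] by (simp add: B_def a_def)
  qed fact+
  moreover have "t / L * a \<le> 2 * real n^5 * real (card G)"
  proof -
    have "t / L * a \<le> \<theta> * real (card \<Gamma>)"
      unfolding \<theta>_def[symmetric] using a\<Gamma> \<theta> by (intro mult_left_mono) auto
    with I(3) show ?thesis by (simp add: G_def)
  qed
  ultimately show False
    using parameter_contradiction[OF t0 t(2) L1 a _ n(2) _ _ small1, of "real (card G)"]
    by (simp add: \<tau>_def B_def)
qed

theorem theorem12p1:
  fixes F :: form and m\<^sub>U :: "(real^4^4) measure"
  assumes "haar_measure_on (ugroup F) m\<^sub>U"
    and "emeasure m\<^sub>U (ubox F) = 1"
  shows "\<exists>M::real. \<forall>\<^sub>F \<epsilon> in at_right (0::real). \<forall>\<^sub>F \<delta> in at_right (0::real).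
           \<forall>A \<subseteq> unit_ball_rrep F.
             outer_measure_of m\<^sub>U (exceptional_set F M \<epsilon> \<delta> A) \<le> ennreal (\<delta> powr \<epsilon>)"
proof (intro exI[of _ 723])
  define L :: real where "L = 6 ^ 16"
  define X where "X = 64 * (9 * L)^10 * 10^448 * L\<^sup>2"
  define Y where "Y = 4 * (9 * L)^3 * measure m\<^sub>U (unip F ` param_box 2)"
  have XY: "0 \<le> X" "0 \<le> Y" unfolding X_def Y_def L_def
    by (intro mult_nonneg_nonneg zero_le_power measure_nonneg zero_le_numeral)+
  define Z where "Z = 1 + X + Y"
  have Z: "1 \<le> Z" using XY by (simp add: Z_def)
  show "\<forall>\<^sub>F \<epsilon> in at_right (0::real). \<forall>\<^sub>F \<delta> in at_right (0::real).
           \<forall>A \<subseteq> unit_ball_rrep F.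
             outer_measure_of m\<^sub>U (exceptional_set F 723 \<epsilon> \<delta> A) \<le> ennreal (\<delta> powr \<epsilon>)"
    using eventually_at_right_less[of 0]
  proof eventually_elim
    case (elim \<epsilon>)
    have "((\<lambda>\<delta>. \<delta> powr \<epsilon>) \<longlongrightarrow> 0) (at_right 0)"
      using elim eventually_at_right_less[of "0::real"]
      by (intro tendsto_zero_powrI[where b = \<epsilon>] tendsto_ident_at tendsto_const)
        (auto elim: eventually_mono)
    then have "\<forall>\<^sub>F \<delta> in at_right 0. \<delta> powr \<epsilon> < 1 / Z"
      by (rule order_tendstoD) (use Z in simp)
    then show ?case
      using eventually_at_right_less[of 0]
    proof eventually_elim
      case (elim \<delta>)
      define t where "t = \<delta> powr \<epsilon>"
      have t: "0 < t" "t * Z < 1" using elim Z by (auto simp: t_def field_simps)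
      have le: "t * z < 1" if "z \<le> Z" for z
        using mult_left_mono[OF that, of t] t by linarith
      have "t < 1" using le[OF Z] by simp
      moreover have "t * X < 1" "t * Y < 1"
        using XY by (intro le; simp add: Z_def)+
      ultimately show ?case
        using exceptional_set_measure_le[OF assms(1) _ elim(2) t_def _ L_def, folded X_def Y_def]
        unfolding t_def by blast
    qed
  qed
qed

end
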